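(* For every virtual string $\Gamma$ and every positive integer $n$, the $u$-polynomial of the $n$-cable $\Gamma_{(n)}$ of $\Gamma$ is given by $$u_{\Gamma_{(n)}}(t)=n^2u_\Gamma(t^n).$$
   Context: Nanowords. A Gauss word is a finite word (possibly empty) in which each letter appears exactly twice or not at all. A nanoword is a Gauss word together with a map $X\mapsto|X|\in\{a,b\}$ from its letters to $\{a,b\}$ ($|X|$ is the type of $X$). An isomorphism of nanowords is a type-preserving relabelling of letters which carries the $k$th letter of one word to the $k$th letter of the other for all $k$. Two nanowords are homotopic if related by a finite sequence of isomorphisms and the following moves and their inverses ($x,y,z,t$ are arbitrary sequences of letters such that both sides are Gauss words, types of letters being unchanged unless stated): shift: $AxAy\leftrightarrow xA'yA'$ where $|A'|\neq|A|$; H1: $xAAy\leftrightarrow xy$; H2: $xAByBAz\leftrightarrow xyz$ where $|A|\ne|B|$; H3: $xAByACzBCt\leftrightarrow xBAyCAzCBt$ where $|A|=|B|=|C|$. Virtual strings. A virtual string is (equivalently to its definition via planar diagrams with real and virtual crossings modulo flattened Reidemeister-type moves) a homotopy class of nanowords. A nanoword represents its class. Linking. Let $\alpha$ be a nanoword. Distinct letters $A,B$ are linked if they alternate in $\alpha$. Set $l(A,B)=0$ if $A=B$ or $A,B$ are not linked. If they occur in the order $\dots A\dots B\dots A\dots B\dots$, set $l(A,B)=1$ if $|A|=|B|$ and $-1$ otherwise; if in the order $\dots B\dots A\dots B\dots A\dots$, set $l(A,B)=-1$ if $|A|=|B|$ and $1$ otherwise. Put $n(X)=\sum_{Y\in\alpha}l(X,Y)$,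 the sum over all letters $Y$ of $\alpha$. The $u$-polynomial. For $k\ge1$ let $u_k(\alpha)=\#\{X\in\alpha\mid n(X)=k\}-\#\{X\in\alpha\mid n(X)=-k\}$ and $u_\alpha(t)=\sum_{k\ge1}u_k(\alpha)t^k$. This is known to be a homotopy invariant; for a virtual string $\Gamma$, $u_\Gamma(t)$ is $u_\alpha(t)$ for any nanoword $\alpha$ representing $\Gamma$. Cables. Let $n\ge1$ and let $\alpha$ be a nanoword. For $0\le i\le n-1$ let $w_i$ be obtained from $\alpha$ by replacing letters as follows (first indices modulo $n$): if $|A|=a$, replace the first occurrence of $A$ by $A_{i,0}A_{i,1}\dotso A_{i,n-1}$ and the second by $A_{n-1,i}A_{n-2,i}\dotso A_{0,i}$; if $|A|=b$, replace the first occurrence of $A$ by $A_{0,i}A_{n-1,i}A_{n-2,i}\dotso A_{1,i}$ and the second by $A_{i+1,0}A_{i+1,1}\dotso A_{i+1,n-1}$. The $n$-cable of $\alpha$ is the nanoword $$\alpha_{(n)}=w_0C_0w_1C_1\dotso C_{n-3}w_{n-2}C_{n-2}w_{n-1}C_{n-2}C_{n-3}\dotso C_1C_0$$ with types: all $C_i$ have type $a$; if $|A|=a$ then $|A_{i,j}|=a$ if $i\le j$ and $b$ if $i>j$; if $|A|=b$ then, with $d\in\{0,\dots,n-1\}$ the residue of $i-1$ modulo $n$, $|A_{i,j}|=a$ if $j>d$ and $b$ if $j\le d$. (Geometrically: take $n$ parallel copies of the curve, numbered $0,\dots,n-1$ from left to right, cut at the base point; join the end of copy $i$ to the start of copy $i+1$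 for $0\le i\le n-2$, and the end of copy $n-1$ to the start of copy $0$ crossing the other $n-1$ arcs.) Homotopic nanowords have homotopic $n$-cables, so for a virtual string $\Gamma$ represented by $\alpha$, $\Gamma_{(n)}$ is defined as the virtual string represented by $\alpha_{(n)}$. *)

theory Defs
  imports
    "HOL-Library.Sublist"
    "HOL-Computational_Algebra.Polynomial"
begin

section \<open>Nanowords and homotopy\<close>

datatype letter_type = Type_a | Type_b

text \<open>
  The second component gives the types of letters.  It is a total function, but only its
  values on the letters occurring in the word matter: two nanowords differing elsewhere
  are isomorphic in the sense below.
\<close>

type_synonym 'x nanoword = "'x list \<times> ('x \<Rightarrow> letter_type)"

definition gauss_word :: "'x list \<Rightarrow> bool" where
  "gauss_word w \<longleftrightarrow> (\<forall>X\<in>set w. count_list w X = 2)"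

definition nanoword :: "'x nanoword \<Rightarrow> bool" where
  "nanoword \<alpha> \<longleftrightarrow> gauss_word (fst \<alpha>)"

definition isomorphic :: "'x nanoword \<Rightarrow> 'y nanoword \<Rightarrow> bool" where
  "isomorphic \<alpha> \<beta> \<longleftrightarrow>
     (\<exists>f. inj_on f (set (fst \<alpha>)) \<and> fst \<beta> = map f (fst \<alpha>) \<and>
          (\<forall>X\<in>set (fst \<alpha>). snd \<beta> (f X) = snd \<alpha> X))"

text \<open>
  The moves, in one direction only and without the requirement that both sides are Gauss
  words; both are supplied by \<open>homotopic\<close>.
\<close>

inductive move :: "'x nanoword \<Rightarrow> 'x nanoword \<Rightarrow> bool" where
  shift: "s \<noteq> \<tau> A \<Longrightarrow> move ([A] @ x @ [A] @ y, \<tau>) (x @ [A'] @ y @ [A'], \<tau>(A' := s))"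
| H1: "move (x @ [A, A] @ y, \<tau>) (x @ y, \<tau>)"
| H2: "\<tau> A \<noteq> \<tau> B \<Longrightarrow> move (x @ [A, B] @ y @ [B, A] @ z, \<tau>) (x @ y @ z, \<tau>)"
| H3: "\<tau> A = \<tau> B \<Longrightarrow> \<tau> B = \<tau> C \<Longrightarrow>
       move (x @ [A, B] @ y @ [A, C] @ z @ [B, C] @ t, \<tau>)
            (x @ [B, A] @ y @ [C, A] @ z @ [C, B] @ t, \<tau>)"

definition homotopic :: "'x nanoword \<Rightarrow> 'x nanoword \<Rightarrow> bool" where
  "homotopic =
     equivclp (\<lambda>\<alpha> \<beta>. nanoword \<alpha> \<and> nanoword \<beta> \<and> (isomorphic \<alpha> \<beta> \<or> move \<alpha> \<beta>))"

text \<open>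
  Virtual strings are homotopy classes of nanowords with letters in \<^typ>\<open>nat\<close>.  This is no
  restriction, since words are finite: a nanoword over any type of letters is isomorphic to
  one over \<^typ>\<open>nat\<close>, and \<open>vstring_of\<close> is the class of such a copy.
\<close>

definition vstring_of :: "'x nanoword \<Rightarrow> nat nanoword set" where
  "vstring_of \<alpha> = {\<gamma>. \<exists>\<beta>. isomorphic \<alpha> \<beta> \<and> nanoword \<beta> \<and> homotopic \<beta> \<gamma>}"

definition virtual_strings :: "nat nanoword set set" where
  "virtual_strings = {vstring_of \<alpha> | \<alpha> :: nat nanoword. nanoword \<alpha>}"


section \<open>The u-polynomial\<close>

text \<open>
  In a Gauss word, \<^term>\<open>subseq [A, B, A, B] w\<close> says that the letters \<open>A\<close>, \<open>B\<close> are linked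
  and occur in the order \<open>A, B, A, B\<close>.
\<close>

definition linking :: "'x nanoword \<Rightarrow> 'x \<Rightarrow> 'x \<Rightarrow> int" where
  "linking \<alpha> A B =
     (if A = B then 0
      else if subseq [A, B, A, B] (fst \<alpha>) then (if snd \<alpha> A = snd \<alpha> B then 1 else -1)
      else if subseq [B, A, B, A] (fst \<alpha>) then (if snd \<alpha> A = snd \<alpha> B then -1 else 1)
      else 0)"

definition linking_sum :: "'x nanoword \<Rightarrow> 'x \<Rightarrow> int" where
  "linking_sum \<alpha> X = (\<Sum>Y\<in>set (fst \<alpha>). linking \<alpha> X Y)"

definition u_coeff :: "'x nanoword \<Rightarrow> nat \<Rightarrow> int" where
  "u_coeff \<alpha> k =
     int (card {X \<in> set (fst \<alpha>). linking_sum \<alpha> X = int k}) -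
     int (card {X \<in> set (fst \<alpha>). linking_sum \<alpha> X = - int k})"

definition u_poly :: "'x nanoword \<Rightarrow> int poly" where
  "u_poly \<alpha> = (\<Sum>k | k \<ge> 1 \<and> u_coeff \<alpha> k \<noteq> 0. monom (u_coeff \<alpha> k) k)"

lemma finite_u_coeff_support: "finite {k. k \<ge> 1 \<and> u_coeff \<alpha> k \<noteq> 0}"
proof (rule finite_subset)
  let ?N = "(\<lambda>X. nat \<bar>linking_sum \<alpha> X\<bar>) ` set (fst \<alpha>)"
  show "finite ?N" by simp
  show "{k. k \<ge> 1 \<and> u_coeff \<alpha> k \<noteq> 0} \<subseteq> ?N"
  proof
    fix k assume k: "k \<in> {k. k \<ge> 1 \<and> u_coeff \<alpha> k \<noteq> 0}"
    show "k \<in> ?N"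
    proof (rule ccontr)
      assume "k \<notin> ?N"
      then have "linking_sum \<alpha> X \<noteq> int k \<and> linking_sum \<alpha> X \<noteq> - int k"
        if "X \<in> set (fst \<alpha>)" for X
        using that by force
      then have "{X \<in> set (fst \<alpha>). linking_sum \<alpha> X = int k} = {}"
        "{X \<in> set (fst \<alpha>). linking_sum \<alpha> X = - int k} = {}"
        by blast+
      then have "u_coeff \<alpha> k = 0" by (simp only: u_coeff_def card.empty)
      then show False using k by simp
    qed
  qed
qed

lemma coeff_u_poly: "coeff (u_poly \<alpha>) k = (if k \<ge> 1 then u_coeff \<alpha> k else 0)"
proof -
  have "coeff (u_poly \<alpha>) k =
      (\<Sum>i | i \<ge> 1 \<and> u_coeff \<alpha> i \<noteq> 0. if i = k then u_coeff \<alpha> i else 0)"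
    unfolding u_poly_def coeff_sum coeff_monom ..
  also have "\<dots> = (if k \<ge> 1 then u_coeff \<alpha> k else 0)"
    using finite_u_coeff_support[of \<alpha>] by (simp add: sum.delta)
  finally show ?thesis .
qed

text \<open>
  By homotopy invariance the image below is a singleton for every virtual string.
\<close>

definition u_vstring :: "nat nanoword set \<Rightarrow> int poly" where
  "u_vstring \<Gamma> = the_elem (u_poly ` \<Gamma>)"


section \<open>Cables\<close>

text \<open>\<open>Sub A i j\<close> and \<open>Conn i\<close> are the letters written \<open>A\<^sub>i\<^sub>,\<^sub>j\<close> and \<open>C\<^sub>i\<close>.\<close>

datatype 'x cable_letter = Sub 'x nat nat | Conn nat

fun first_occurrence :: "nat \<Rightarrow> letter_type \<Rightarrow> nat \<Rightarrow> 'x \<Rightarrow> 'x cable_letter list" where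
  "first_occurrence n Type_a i A = map (\<lambda>j. Sub A i j) [0..<n]"
| "first_occurrence n Type_b i A = Sub A 0 i # map (\<lambda>k. Sub A k i) (rev [1..<n])"

fun second_occurrence :: "nat \<Rightarrow> letter_type \<Rightarrow> nat \<Rightarrow> 'x \<Rightarrow> 'x cable_letter list" where
  "second_occurrence n Type_a i A = map (\<lambda>k. Sub A k i) (rev [0..<n])"
| "second_occurrence n Type_b i A = map (\<lambda>j. Sub A ((i + 1) mod n) j) [0..<n]"

definition cable_strand :: "nat \<Rightarrow> 'x nanoword \<Rightarrow> nat \<Rightarrow> 'x cable_letter list" where
  "cable_strand n \<alpha> i =
     concat (map (\<lambda>p. let A = fst \<alpha> ! p in
                        if A \<notin> set (take p (fst \<alpha>))
                        then first_occurrence n (snd \<alpha> A) i A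
                        else second_occurrence n (snd \<alpha> A) i A)
                 [0..<length (fst \<alpha>)])"

text \<open>For natural numbers \<open>i\<close> and \<open>n \<ge> 1\<close>, the residue of \<open>i - 1\<close> is \<open>(i + n - 1) mod n\<close>.\<close>

fun cable_type :: "nat \<Rightarrow> ('x \<Rightarrow> letter_type) \<Rightarrow> 'x cable_letter \<Rightarrow> letter_type" where
  "cable_type n \<tau> (Conn i) = Type_a"
| "cable_type n \<tau> (Sub A i j) =
     (case \<tau> A of
        Type_a \<Rightarrow> if i \<le> j then Type_a else Type_b
      | Type_b \<Rightarrow> if j > (i + n - 1) mod n then Type_a else Type_b)"

definition cable :: "nat \<Rightarrow> 'x nanoword \<Rightarrow> 'x cable_letter nanoword" where
  "cable n \<alpha> =
     (concat (map (\<lambda>i. cable_strand n \<alpha> i @ [Conn i]) [0..<n - 1])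
        @ cable_strand n \<alpha> (n - 1) @ map Conn (rev [0..<n - 1]),
      cable_type n (snd \<alpha>))"

text \<open>
  Homotopic nanowords have homotopic cables, so all the sets in this union are equal
  when \<open>\<Gamma>\<close> is a virtual string and \<open>n \<ge> 1\<close>.
\<close>

definition cable_vstring :: "nat \<Rightarrow> nat nanoword set \<Rightarrow> nat nanoword set" where
  "cable_vstring n \<Gamma> = (\<Union>\<alpha>\<in>\<Gamma>. vstring_of (cable n \<alpha>))"

end

theory Submission
  imports Defs
begin

text \<open>
  Give the occurrences of a letter \<open>X\<close> opposite signs: the first one is positive if \<open>X\<close> has type
  \<open>a\<close> and negative if it has type \<open>b\<close>.  Let the level of a position be the sum of the signs before
  it.  Then \<open>n(X)\<close> is the level before the negative occurrence of \<open>X\<close> minus the level after the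
  positive one.  A shift move rotates the signed word, which changes all levels by the same
  constant; the letters removed by H1 have \<open>n(X) = 0\<close>, those removed by H2 have opposite values,
  and H3 preserves all values.

  In the \<open>n\<close>-cable every signed occurrence of a letter of \<open>\<alpha>\<close> becomes, in every strand, a block
  of \<open>n\<close> letters of the same sign.  So all levels are multiplied by \<open>n\<close> up to offsets that cancel:
  each of the \<open>n\<^sup>2\<close> letters \<open>A\<^sub>i\<^sub>,\<^sub>j\<close> has value \<open>n \<cdot> n(A)\<close>, and the connecting letters have
  value \<open>0\<close>.
\<close>

section \<open>Signed words and levels\<close>

fun signed_from :: "('x \<Rightarrow> letter_type) \<Rightarrow> 'x set \<Rightarrow> 'x list \<Rightarrow> ('x \<times> bool) list" where
  "signed_from \<tau> S [] = []"
| "signed_from \<tau> S (X # w) = (X, (X \<notin> S) = (\<tau> X = Type_a)) # signed_from \<tau> (insert X S) w"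

text \<open>
  The sign \<^term>\<open>True\<close> marks the first occurrence of a letter of type \<open>a\<close> and the second
  occurrence of a letter of type \<open>b\<close>; unlike the types, the signs survive the shift move.
\<close>

definition signed_word :: "'x nanoword \<Rightarrow> ('x \<times> bool) list" where
  "signed_word \<alpha> = signed_from (snd \<alpha>) {} (fst \<alpha>)"

fun height :: "('x \<times> bool) list \<Rightarrow> int" where
  "height [] = 0"
| "height (e # s) = (if snd e then 1 else -1) + height s"

fun level :: "('x \<times> bool) list \<Rightarrow> 'x \<times> bool \<Rightarrow> int" where
  "level [] e = 0"
| "level (f # s) e = (if f = e then 0 else (if snd f then 1 else -1) + level s e)"

text \<open>\<open>level\<close> counts the entries before a position, so
  \<open>level s (X, True) + 1\<close> is the level just after the positive entry; this is where the
  \<open>- 1\<close> comes from.\<close>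

definition index :: "('x \<times> bool) list \<Rightarrow> 'x \<Rightarrow> int" where
  "index s X = level s (X, False) - level s (X, True) - 1"

text \<open>A signed indicator that is odd in \<open>m\<close>. In particular it vanishes at
  \<open>m = 0\<close> even for \<open>k = 0\<close>, so letters of index 0 never count and letters
  of opposite index cancel.\<close>

definition weight :: "nat \<Rightarrow> int \<Rightarrow> int" where
  "weight k m = of_bool (m = int k) - of_bool (m = - int k)"

definition u_count :: "('x \<times> bool) list \<Rightarrow> nat \<Rightarrow> int" where
  "u_count s k = (\<Sum>X\<in>fst ` set s. weight k (index s X))"

text \<open>The signed counterpart of a Gauss word: every letter present has exactly one positive
  and exactly one negative entry.\<close>

definition balanced :: "('x \<times> bool) list \<Rightarrow> bool" where
  "balanced s \<longleftrightarrow> distinct s \<and> set s = fst ` set s \<times> UNIV"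

lemma signed_from_append:
  "signed_from \<tau> S (u @ v) = signed_from \<tau> S u @ signed_from \<tau> (S \<union> set u) v"
  by (induction u arbitrary: S) auto

lemma map_fst_signed_from [simp]: "map fst (signed_from \<tau> S w) = w"
  by (induction w arbitrary: S) auto

lemma fst_set_signed_from [simp]: "fst ` set (signed_from \<tau> S w) = set w"
  by (metis map_fst_signed_from list.set_map)

lemma set_signed_fromD: "(X, c) \<in> set (signed_from \<tau> S w) \<Longrightarrow> X \<in> set w"
  by (metis fst_set_signed_from fst_conv imageI)

lemma notin_set_signed_from [simp]: "X \<notin> set w \<Longrightarrow> (X, c) \<notin> set (signed_from \<tau> S w)"
  using set_signed_fromD by metis

lemma signed_from_cong:
  "(\<And>X. X \<in> set w \<Longrightarrow> \<tau> X = \<tau>' X \<and> (X \<in> S \<longleftrightarrow> X \<in> S')) \<Longrightarrow>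
   signed_from \<tau> S w = signed_from \<tau>' S' w"
  by (induction w arbitrary: S S') auto

lemma signed_from_map:
  assumes "inj_on f (S \<union> set w)" and "\<And>X. X \<in> set w \<Longrightarrow> \<tau>' (f X) = \<tau> X"
  shows "signed_from \<tau>' (f ` S) (map f w) = map (apfst f) (signed_from \<tau> S w)"
  using assms
proof (induction w arbitrary: S)
  case (Cons X w)
  have "f X \<in> f ` S \<longleftrightarrow> X \<in> S"
    using Cons.prems(1) by (auto simp: inj_on_def)
  moreover have "signed_from \<tau>' (f ` insert X S) (map f w) =
      map (apfst f) (signed_from \<tau> (insert X S) w)"
    using Cons.prems by (intro Cons.IH) auto
  ultimately show ?case
    using Cons.prems(2) by simp
qed simp

text \<open>Only the first occurrence of a letter outside \<open>S\<close> gets the sign belonging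
  to a first occurrence; all others get the opposite one. For an absent letter \<open>min 1\<close>
  and the truncated subtraction both give 0.\<close>

lemma count_signed_from:
  "count_list (signed_from \<tau> S w) (X, c) =
     (if X \<in> S then (if c = (\<tau> X \<noteq> Type_a) then count_list w X else 0)
      else if c = (\<tau> X = Type_a) then min 1 (count_list w X)
      else count_list w X - 1)"
  by (induction w arbitrary: S) (auto simp: min_def)

lemma distinct_if_count_list_le_1: "(\<And>x. count_list xs x \<le> 1) \<Longrightarrow> distinct xs"
proof (induction xs)
  case (Cons y ys)
  have "count_list ys x \<le> 1" for x
    using Cons.prems[of x] by (auto split: if_splits)
  moreover have "count_list ys y = 0"
    using Cons.prems[of y] by simp
  ultimately show ?case
    using Cons.IH by (auto simp: count_list_0_iff)
qed simp

lemma balanced_signed_word: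
  assumes "nanoword \<alpha>"
  shows "balanced (signed_word \<alpha>)"
proof -
  have cnt: "count_list (signed_word \<alpha>) (X, c) = (if X \<in> set (fst \<alpha>) then 1 else 0)" for X c
    using assms by (auto simp: signed_word_def count_signed_from nanoword_def gauss_word_def)
  have "(X, c) \<in> set (signed_word \<alpha>) \<longleftrightarrow> X \<in> set (fst \<alpha>)" for X c
    using cnt[of X c] count_list_0_iff[of "signed_word \<alpha>" "(X, c)"] by (auto split: if_splits)
  then have "set (signed_word \<alpha>) = set (fst \<alpha>) \<times> UNIV"
    by auto
  moreover have "distinct (signed_word \<alpha>)"
    by (rule distinct_if_count_list_le_1) (auto simp: cnt split: prod.splits)
  ultimately show ?thesis
    by (auto simp: balanced_def signed_word_def)
qed

lemma height_append [simp]: "height (s @ t) = height s + height t"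
  by (induction s) auto

lemma level_append:
  "level (s @ t) e = (if e \<in> set s then level s e else height s + level t e)"
  by (induction s) auto

lemma level_map:
  assumes "inj_on f (fst ` set s)" "X \<in> fst ` set s"
  shows "level (map (apfst f) s) (f X, c) = level s (X, c)"
proof -
  \<comment> \<open>The induction runs over a separate list \<open>t\<close>, so that the domain of
    injectivity stays fixed.\<close>
  have "level (map (apfst f) t) (f X, c) = level t (X, c)" if "set t \<subseteq> set s" for t
    using that
  proof (induction t)
    case (Cons e t)
    obtain Y d where e: "e = (Y, d)" by (cases e)
    have "Y \<in> fst ` set s" using Cons.prems unfolding e by force
    then have "f Y = f X \<longleftrightarrow> Y = X"
      by (rule inj_on_eq_iff[OF assms(1) _ assms(2)])
    then have "level (map (apfst f) (e # t)) (f X, c) = (if e = (X, c) then 0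
        else (if d then 1 else -1) + level (map (apfst f) t) (f X, c))"
      by (simp add: e)
    moreover have "level (map (apfst f) t) (f X, c) = level t (X, c)"
      using Cons.prems by (intro Cons.IH) simp
    ultimately show ?case by (simp only: e level.simps snd_conv)
  qed simp
  then show ?thesis by blast
qed

lemma u_count_map:
  assumes "inj_on f (fst ` set s)"
  shows "u_count (map (apfst f) s) k = u_count s k"
proof -
  have index: "index (map (apfst f) s) (f X) = index s X" if "X \<in> fst ` set s" for X
    unfolding index_def level_map[OF assms that] ..
  have "fst ` set (map (apfst f) s) = f ` fst ` set s"
    by (simp only: set_map image_image fst_apfst)
  then have "u_count (map (apfst f) s) k =
      (\<Sum>X\<in>fst ` set s. weight k (index (map (apfst f) s) (f X)))"
    unfolding u_count_def by (simp only: sum.reindex[OF assms] o_def)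
  also have "\<dots> = u_count s k"
    unfolding u_count_def by (rule sum.cong[OF refl]) (simp only: index)
  finally show ?thesis .
qed

lemma height_balanced:
  assumes "balanced s"
  shows "height s = 0"
proof -
  have "height t = (\<Sum>e\<in>set t. if snd e then 1 else -1)" if "distinct t" for t :: "('a \<times> bool) list"
    using that by (induction t) auto
  then have "height s = (\<Sum>e\<in>fst ` set s \<times> UNIV. if snd e then 1 else -1)"
    using assms by (metis balanced_def)
  also have "\<dots> = (\<Sum>X\<in>fst ` set s. \<Sum>c\<in>UNIV. if c then 1 else -1)"
    by (simp only: sum.cartesian_product split_def snd_conv)
  also have "\<dots> = 0" by (simp add: UNIV_bool)
  finally show ?thesis .
qed

text \<open>Every level grows by \<open>height t\<close>: directly for the entries of
  \<open>s\<close>, and for those of \<open>t\<close> because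
  \<open>height s + height t = 0\<close>. Differences of levels are therefore unchanged.\<close>

lemma u_count_rotate:
  assumes "balanced (s @ t)"
  shows "u_count (t @ s) k = u_count (s @ t) k"
proof -
  have h: "height s + height t = 0" using height_balanced[OF assms] by simp
  have "index (t @ s) X = index (s @ t) X" if "X \<in> fst ` set (s @ t)" for X
  proof -
    have "level (t @ s) (X, c) = height t + level (s @ t) (X, c)" for c
    proof -
      have "(X, c) \<in> set s \<union> set t" "\<not> ((X, c) \<in> set s \<and> (X, c) \<in> set t)"
        using assms that unfolding balanced_def by auto
      then show ?thesis using h by (auto simp: level_append)
    qed
    then show ?thesis by (simp add: index_def)
  qed
  moreover have "fst ` set (t @ s) = fst ` set (s @ t)" by auto
  ultimately show ?thesis
    by (simp add: u_count_def Un_commute del: set_append)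
qed

text \<open>
  Letters with both occurrences in \<open>w\<close> cancel, so only those with a single one contribute.
\<close>

lemma height_signed_from:
  fixes w :: "'x list"
  assumes "finite V" "set w \<subseteq> V"
  shows "height (signed_from \<tau> S w) =
    (\<Sum>Y\<in>V. (if \<tau> Y = Type_a then 1 else -1) *
       (if Y \<in> S then - int (count_list w Y)
        else if Y \<in> set w then 2 - int (count_list w Y) else 0))"
proof -
  define g :: "'x \<Rightarrow> int" where "g Y = (if \<tau> Y = Type_a then 1 else -1)" for Y
  define F :: "'x set \<Rightarrow> 'x list \<Rightarrow> 'x \<Rightarrow> int" where
    "F S w Y = (if Y \<in> S then - int (count_list w Y)
        else if Y \<in> set w then 2 - int (count_list w Y) else 0)" for S w Y
  have "height (signed_from \<tau> S w) = (\<Sum>Y\<in>V. g Y * F S w Y)"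
    using assms(2)
  proof (induction w arbitrary: S)
    case Nil
    have "F S [] Y = 0" for Y by (simp add: F_def)
    then show ?case by simp
  next
    case (Cons X w)
    then have X: "X \<in> V" by simp
    \<comment> \<open>Reading \<open>X\<close> alters only the summand at \<open>X\<close>, and it
      alters it by exactly the sign of the entry read.\<close>
    have "F S (X # w) Y = F (insert X S) w Y" if "Y \<noteq> X" for Y
      using that by (auto simp: F_def)
    then have "(\<Sum>Y\<in>V - {X}. g Y * F S (X # w) Y) = (\<Sum>Y\<in>V - {X}. g Y * F (insert X S) w Y)"
      by (intro sum.cong) auto
    moreover have "g X * F S (X # w) X - g X * F (insert X S) w X =
        (if (X \<notin> S) = (\<tau> X = Type_a) then 1 else -1)"
      by (cases "\<tau> X") (auto simp: F_def g_def)
    moreover have "height (signed_from \<tau> (insert X S) w) = (\<Sum>Y\<in>V. g Y * F (insert X S) w Y)"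
      using Cons by simp
    ultimately show ?case
      unfolding signed_from.simps height.simps snd_conv
        sum.remove[OF assms(1) X, of "\<lambda>Y. g Y * F S (X # w) Y"]
        sum.remove[OF assms(1) X, of "\<lambda>Y. g Y * F (insert X S) w Y"]
      by linarith
  qed
  then show ?thesis by (simp only: F_def g_def)
qed

section \<open>Linking numbers read off from the signed word\<close>

lemma gauss_word_split:
  assumes "gauss_word w" "X \<in> set w"
  obtains x y z where "w = x @ X # y @ X # z" "X \<notin> set x" "X \<notin> set y" "X \<notin> set z"
proof -
  have "count_list w X = Suc 1" using assms by (simp add: gauss_word_def)
  from count_list_Suc_split_first[OF this]
  obtain x r where r: "w = x @ X # r" "X \<notin> set x" "count_list r X = Suc 0"
    by auto
  from count_list_Suc_split_first[OF r(3)]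
  obtain y z where "r = y @ X # z" "X \<notin> set y" "count_list z X = 0"
    by auto
  with r show thesis by (intro that[of x y z]) (auto simp: count_list_0_iff)
qed

lemma subseq_Cons_skip: "X \<notin> set x \<Longrightarrow> subseq (X # ps) (x @ r) \<longleftrightarrow> subseq (X # ps) r"
proof (induction x)
  case (Cons a x)
  then have "a \<noteq> X" by auto
  with Cons show ?case by simp
qed simp

lemma not_subseq_if_notin: "X \<in> set ps \<Longrightarrow> X \<notin> set r \<Longrightarrow> \<not> subseq ps r"
  by (auto elim: list_emb_set)

context
  fixes X Y :: 'x and x y z :: "'x list"
  assumes XY: "X \<noteq> Y" and X: "X \<notin> set x" "X \<notin> set y" "X \<notin> set z"
begin

text \<open>The \<open>X\<close> of the pattern can only be matched with the single \<open>X\<close>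
  of the list, so the two copies of \<open>Y\<close> must lie on its two sides.\<close>

lemma subseq_YXY_iff: "subseq [Y, X, Y] (y @ X # z) \<longleftrightarrow> Y \<in> set y \<and> Y \<in> set z"
  using X(2)
proof (induction y)
  case Nil
  then show ?case using XY X(3) by (simp add: not_subseq_if_notin[of X])
next
  case (Cons a y)
  then show ?case
    using XY by (cases "a = Y") (auto simp: subseq_Cons_skip subseq_singleton_left)
qed

lemma subseq_XYXY_iff:
  "subseq [X, Y, X, Y] (x @ X # y @ X # z) \<longleftrightarrow> Y \<in> set y \<and> Y \<in> set z"
  using X(1) by (simp add: subseq_Cons_skip subseq_YXY_iff)

lemma subseq_YX_iff: "subseq [Y, X] (y @ X # z) \<longleftrightarrow> Y \<in> set y"
  using X(2)
proof (induction y)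
  case Nil
  then show ?case using XY X(3) by (simp add: not_subseq_if_notin[of X])
next
  case (Cons a y)
  then show ?case
    using XY by (cases "a = Y") (auto simp: subseq_Cons_skip)
qed

lemma not_subseq_YXYX: "\<not> subseq [Y, X, Y, X] (y @ X # z)"
  using X(2)
proof (induction y)
  case Nil
  then show ?case using XY X(3) by (simp add: not_subseq_if_notin[of X])
next
  case (Cons a y)
  then show ?case
    using XY X(3) by (cases "a = Y") (auto simp: subseq_Cons_skip not_subseq_if_notin[of X])
qed

text \<open>The pattern uses up both occurrences of \<open>X\<close>; one \<open>Y\<close> has to
  precede the first of them and the other has to lie between them.\<close>

lemma subseq_YXYX_iff:
  "subseq [Y, X, Y, X] (x @ X # y @ X # z) \<longleftrightarrow> Y \<in> set x \<and> Y \<in> set y"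
  using X(1)
proof (induction x)
  case Nil
  then show ?case using XY not_subseq_YXYX by simp
next
  case (Cons a x)
  have "subseq [X, Y, X] (x @ X # y @ X # z) \<longleftrightarrow> Y \<in> set y" if "X \<notin> set x"
    using that by (simp add: subseq_Cons_skip subseq_YX_iff)
  then show ?case
    using Cons XY by (cases "a = Y") auto
qed

end

text \<open>Write the word as \<open>x X y X z\<close>. A letter is linked with \<open>X\<close>
  exactly when it occurs once in \<open>y\<close>, and its sign there gives the linking number up to
  the sign \<open>g X\<close>. Letters occurring twice in \<open>y\<close> cancel in the height of
  \<open>y\<close>, so both sides equal \<open>g X\<close> times that height.\<close>

lemma linking_sum_eq_index:
  assumes "nanoword \<alpha>" "X \<in> set (fst \<alpha>)"
  shows "linking_sum \<alpha> X = index (signed_word \<alpha>) X"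
proof -
  define w \<tau> where "w = fst \<alpha>" and "\<tau> = snd \<alpha>"
  have gw: "gauss_word w" "X \<in> set w" using assms by (auto simp: w_def nanoword_def)
  then obtain x y z where w: "w = x @ X # y @ X # z"
    and X: "X \<notin> set x" "X \<notin> set y" "X \<notin> set z"
    by (rule gauss_word_split)
  define g :: "'a \<Rightarrow> int" where "g Y = (if \<tau> Y = Type_a then 1 else -1)" for Y
  define y' where "y' = signed_from \<tau> (insert X (set x)) y"
  \<comment> \<open>For type a the positive entry of \<open>X\<close> comes first and the level
    difference is \<open>1 + height y'\<close>; for type b the order is reversed and the difference
    is \<open>1 - height y'\<close>.\<close>
  have "index (signed_word \<alpha>) X = g X * height y'"
    using X by (auto simp: signed_word_def w_def[symmetric] \<tau>_def[symmetric] w signed_from_append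
        index_def level_append y'_def g_def)
  moreover have "linking_sum \<alpha> X = g X * height y'"
  proof -
    \<comment> \<open>The bracket is the summand of \<open>height_signed_from\<close> for
      \<open>y\<close> read after \<open>x\<close> and \<open>X\<close>. It is -1 if
      \<open>Y\<close> lies once in \<open>x\<close> and once in \<open>y\<close>, 1 if once in
      \<open>y\<close> and once in \<open>z\<close>, and 0 otherwise.\<close>
    have "linking \<alpha> X Y = g X * (g Y *
       (if Y \<in> insert X (set x) then - int (count_list y Y)
        else if Y \<in> set y then 2 - int (count_list y Y) else 0))" if "Y \<in> set w" for Y
    proof (cases "X = Y")
      case True
      then show ?thesis using X by (simp add: linking_def)
    next
      case False
      have "count_list x Y + count_list y Y + count_list z Y = 2"
        using gw(1)[unfolded gauss_word_def, rule_format, OF that] False by (simp add: w)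
      then consider "count_list x Y = 2 \<or> count_list z Y = 2 \<or> count_list x Y = 1 \<and> count_list z Y = 1"
            "count_list y Y = 0"
        | "count_list x Y = 0" "count_list y Y = 2" "count_list z Y = 0"
        | "count_list x Y = 1" "count_list y Y = 1" "count_list z Y = 0"
        | "count_list x Y = 0" "count_list y Y = 1" "count_list z Y = 1"
        by linarith
      moreover have mem: "Y \<in> set v \<longleftrightarrow> count_list v Y \<noteq> 0" for v
        by (simp add: count_list_0_iff)
      have "linking \<alpha> X Y = (if Y \<in> set y \<and> Y \<in> set z then g X * g Y
          else if Y \<in> set x \<and> Y \<in> set y then - g X * g Y else 0)"
        unfolding linking_def w_def[symmetric] \<tau>_def[symmetric] w
          subseq_XYXY_iff[OF False X] subseq_YXYX_iff[OF False X]
        using False by (cases "\<tau> X"; cases "\<tau> Y") (simp_all add: g_def)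
      ultimately show ?thesis using False
        by cases (simp_all add: mem)
    qed
    moreover have "set y \<subseteq> set w" by (auto simp: w)
    ultimately show ?thesis
      unfolding linking_sum_def w_def[symmetric] y'_def
      by (subst height_signed_from[of "set w"])
        (simp_all only: sum_distrib_left g_def finite_set cong: sum.cong)
  qed
  ultimately show ?thesis by simp
qed

lemma u_coeff_eq_u_count:
  assumes "nanoword \<alpha>"
  shows "u_coeff \<alpha> k = u_count (signed_word \<alpha>) k"
proof -
  have card: "int (card {X \<in> A. P X}) = (\<Sum>X\<in>A. of_bool (P X))" if "finite A" for A :: "'a set" and P
  proof -
    have "{X \<in> A. P X} = A \<inter> {X. P X}" by blast
    then show ?thesis using that by simp
  qed
  have "u_coeff \<alpha> k = (\<Sum>X\<in>set (fst \<alpha>). weight k (linking_sum \<alpha> X))"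
    unfolding u_coeff_def weight_def sum_subtractf by (simp only: card finite_set)
  also have "\<dots> = u_count (signed_word \<alpha>) k"
    using assms by (simp add: u_count_def signed_word_def linking_sum_eq_index)
  finally show ?thesis .
qed


section \<open>Invariance under homotopy\<close>

lemma weight_0 [simp]: "weight k 0 = 0"
  by (simp add: weight_def)

lemma weight_minus: "weight k (- m) = - weight k m"
  by (auto simp: weight_def of_bool_def)

lemma u_count_isomorphic:
  assumes "isomorphic \<alpha> \<beta>"
  shows "u_count (signed_word \<beta>) k = u_count (signed_word \<alpha>) k"
proof -
  obtain f where f: "inj_on f (set (fst \<alpha>))" "fst \<beta> = map f (fst \<alpha>)"
      "\<And>X. X \<in> set (fst \<alpha>) \<Longrightarrow> snd \<beta> (f X) = snd \<alpha> X"
    using assms by (auto simp: isomorphic_def)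
  have "signed_word \<beta> = map (apfst f) (signed_word \<alpha>)"
    using signed_from_map[of f "{}" "fst \<alpha>" "snd \<beta>" "snd \<alpha>"] f by (simp add: signed_word_def)
  moreover have "inj_on f (fst ` set (signed_word \<alpha>))"
    using f(1) by (simp add: signed_word_def)
  ultimately show ?thesis
    by (simp only: u_count_map)
qed

text \<open>Moving the first occurrence of the letter to the end swaps the roles of its two
  occurrences, and the change of type compensates this. So up to renaming, the first signed entry
  just moves to the end.\<close>

lemma u_count_shift:
  assumes \<alpha>_def: "\<alpha> = ([A] @ x @ [A] @ y, \<tau>)"
    and \<beta>_def: "\<beta> = (x @ [A'] @ y @ [A'], \<tau>(A' := s))"
    and nanowords: "nanoword \<alpha>" "nanoword \<beta>" and "s \<noteq> \<tau> A"
  shows "u_count (signed_word \<beta>) k = u_count (signed_word \<alpha>) k"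
proof -
  have A: "A \<notin> set x" "A \<notin> set y"
    using nanowords(1) by (auto simp: \<alpha>_def nanoword_def gauss_word_def count_list_0_iff)
  have A': "A' \<notin> set x" "A' \<notin> set y"
    using nanowords(2) by (auto simp: \<beta>_def nanoword_def gauss_word_def count_list_0_iff)
  \<comment> \<open>The renaming is injective on the letters involved, since \<open>A'\<close>
    occurs neither in \<open>x\<close> nor in \<open>y\<close>.\<close>
  define f where "f = id(A := A')"
  define c where "c \<longleftrightarrow> \<tau> A = Type_a"
  define u where "u = signed_from \<tau> {} x"
  define v where "v = signed_from \<tau> (set x) y"
  have s: "s = Type_a \<longleftrightarrow> \<not> c"
    using assms(5) by (cases s; cases "\<tau> A") (auto simp: c_def)
  have fid: "map (apfst f) (signed_from \<sigma> S w) = signed_from \<sigma> S w" if "A \<notin> set w" for \<sigma> S w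
    using that by (intro map_idI) (auto simp: f_def dest: set_signed_fromD)
  have "signed_from \<tau> {A} x = u" "signed_from \<tau> (insert A (set x)) y = v"
    unfolding u_def v_def using A by (auto intro!: signed_from_cong)
  then have \<alpha>: "signed_word \<alpha> = [(A, c)] @ (u @ [(A, \<not> c)] @ v)"
    by (simp add: \<alpha>_def signed_word_def signed_from_append c_def)
  have "signed_from (\<tau>(A' := s)) {} x = u"
      "signed_from (\<tau>(A' := s)) (insert A' (set x)) y = v"
    unfolding u_def v_def using A' by (auto intro!: signed_from_cong)
  then have "signed_word \<beta> = u @ [(A', \<not> c)] @ v @ [(A', c)]"
    using A' s by (simp add: \<beta>_def signed_word_def signed_from_append)
  also have "\<dots> = map (apfst f) ((u @ [(A, \<not> c)] @ v) @ [(A, c)])"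
    using A by (simp add: fid u_def v_def del: map_eq_conv) (simp add: f_def)
  finally have "u_count (signed_word \<beta>) k = u_count ((u @ [(A, \<not> c)] @ v) @ [(A, c)]) k"
  proof (simp only:, intro u_count_map)
    show "inj_on f (fst ` set ((u @ [(A, \<not> c)] @ v) @ [(A, c)]))"
      using A' by (auto simp: inj_on_def f_def u_def v_def dest: set_signed_fromD)
  qed
  also have "\<dots> = u_count (signed_word \<alpha>) k"
    using balanced_signed_word[OF nanowords(1)] unfolding \<alpha> by (rule u_count_rotate)
  finally show ?thesis .
qed

text \<open>The two removed entries are adjacent with opposite signs: no other level changes, and
  the removed letter has index 0, hence weight 0.\<close>

lemma u_count_H1:
  assumes \<alpha>_def: "\<alpha> = (x @ [A, A] @ y, \<tau>)"
    and \<beta>_def: "\<beta> = (x @ y, \<tau>)"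
    and nw: "nanoword \<alpha>"
  shows "u_count (signed_word \<beta>) k = u_count (signed_word \<alpha>) k"
proof -
  have A: "A \<notin> set x" "A \<notin> set y"
    using nw by (auto simp: \<alpha>_def nanoword_def gauss_word_def count_list_0_iff)
  define c where "c \<longleftrightarrow> \<tau> A = Type_a"
  define u where "u = signed_from \<tau> {} x"
  define v where "v = signed_from \<tau> (set x) y"
  have fst: "fst ` set u = set x" "fst ` set v = set y"
    by (simp_all add: u_def v_def)
  have nA: "(A, d) \<notin> set u" "(A, d) \<notin> set v" for d
    using A by (simp_all add: u_def v_def)
  have "signed_from \<tau> (insert A (set x)) y = v"
    unfolding v_def using A by (auto intro!: signed_from_cong)
  then have \<alpha>: "signed_word \<alpha> = u @ [(A, c), (A, \<not> c)] @ v"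
    using A by (simp add: \<alpha>_def \<beta>_def signed_word_def signed_from_append c_def u_def)
  have \<beta>: "signed_word \<beta> = u @ v"
    by (simp add: \<alpha>_def \<beta>_def signed_word_def signed_from_append u_def v_def)
  have "index (u @ [(A, c), (A, \<not> c)] @ v) A = 0"
    using nA by (cases c) (simp_all add: index_def level_append)
  moreover have index_eq: "index (u @ [(A, c), (A, \<not> c)] @ v) X = index (u @ v) X" if "X \<noteq> A" for X
    using that by (cases c) (simp_all add: index_def level_append)
  have "(\<Sum>X\<in>set x \<union> set y. weight k (index (u @ [(A, c), (A, \<not> c)] @ v) X)) =
      (\<Sum>X\<in>set x \<union> set y. weight k (index (u @ v) X))"
    using A by (intro sum.cong refl arg_cong[of _ _ "weight k"] index_eq) auto
  ultimately show ?thesis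
    using A unfolding u_count_def \<alpha> \<beta> by (simp add: image_Un fst)
qed

text \<open>As the types differ, each removed pair of neighbours has opposite signs and leaves all
  other levels unchanged. The indices of \<open>A\<close> and \<open>B\<close> are plus and minus
  the height of the part between the pairs, so their weights cancel.\<close>

lemma u_count_H2:
  assumes \<alpha>_def: "\<alpha> = (x @ [A, B] @ y @ [B, A] @ z, \<tau>)"
    and \<beta>_def: "\<beta> = (x @ y @ z, \<tau>)"
    and nw: "nanoword \<alpha>" and types: "\<tau> A \<noteq> \<tau> B"
  shows "u_count (signed_word \<beta>) k = u_count (signed_word \<alpha>) k"
proof -
  have AB: "A \<noteq> B" using types by auto
  have A: "A \<notin> set x" "A \<notin> set y" "A \<notin> set z" and B: "B \<notin> set x" "B \<notin> set y" "B \<notin> set z"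
    using nw AB by (auto simp: \<alpha>_def nanoword_def gauss_word_def count_list_0_iff)
  define c where "c \<longleftrightarrow> \<tau> A = Type_a"
  have B_type: "\<tau> B = Type_a \<longleftrightarrow> \<not> c"
    using types by (cases "\<tau> A"; cases "\<tau> B") (auto simp: c_def)
  define u where "u = signed_from \<tau> {} x"
  define v where "v = signed_from \<tau> (set x) y"
  define t where "t = signed_from \<tau> (set x \<union> set y) z"
  have fst: "fst ` set u = set x" "fst ` set v = set y" "fst ` set t = set z"
    by (simp_all add: u_def v_def t_def)
  have nA: "(A, d) \<notin> set u" "(A, d) \<notin> set v" "(A, d) \<notin> set t"
    and nB: "(B, d) \<notin> set u" "(B, d) \<notin> set v" "(B, d) \<notin> set t" for d
    using A B by (simp_all add: u_def v_def t_def)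
  have "signed_from \<tau> (insert B (insert A (set x))) y = v"
    "signed_from \<tau> (insert B (insert A (set x)) \<union> set y) z = t"
    unfolding v_def t_def using A B by (auto intro!: signed_from_cong)
  then have \<alpha>: "signed_word \<alpha> = u @ [(A, c), (B, \<not> c)] @ v @ [(B, c), (A, \<not> c)] @ t"
    using A B AB by (simp add: \<alpha>_def \<beta>_def signed_word_def signed_from_append
        c_def[symmetric] B_type u_def insert_absorb insert_commute)
  have \<beta>: "signed_word \<beta> = u @ v @ t"
    by (simp add: \<alpha>_def \<beta>_def signed_word_def signed_from_append u_def v_def t_def)
  define s where "s = u @ [(A, c), (B, \<not> c)] @ v @ [(B, c), (A, \<not> c)] @ t"
  have "index s A = - index s B"
    using nA nB AB by (cases c) (simp_all add: s_def index_def level_append)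
  moreover have index_eq: "index s X = index (u @ v @ t) X" if "X \<noteq> A" "X \<noteq> B" for X
    using that by (cases c) (simp_all add: s_def index_def level_append)
  have "(\<Sum>X\<in>set x \<union> (set y \<union> set z). weight k (index s X)) =
      (\<Sum>X\<in>set x \<union> (set y \<union> set z). weight k (index (u @ v @ t) X))"
    using A B by (intro sum.cong refl arg_cong[of _ _ "weight k"] index_eq) auto
  moreover have "fst ` set s = insert A (insert B (set x \<union> (set y \<union> set z)))"
    by (auto simp: s_def image_Un fst)
  ultimately show ?thesis
    using A B AB unfolding u_count_def \<alpha> \<beta> s_def[symmetric]
    by (simp add: image_Un fst weight_minus)
qed

text \<open>Swapping neighbours changes only the levels of the swapped entries. In type a, both
  levels of \<open>A\<close> and both levels of \<open>C\<close> rise by 1 and both levels of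
  \<open>B\<close> drop by 1; in type b all of this is reversed. Each index is a difference of two
  levels and survives.\<close>

lemma u_count_H3:
  assumes \<alpha>_def: "\<alpha> = (x @ [A, B] @ y @ [A, C] @ z @ [B, C] @ t, \<tau>)"
    and \<beta>_def: "\<beta> = (x @ [B, A] @ y @ [C, A] @ z @ [C, B] @ t, \<tau>)"
    and nw: "nanoword \<alpha>" and types: "\<tau> A = \<tau> B" "\<tau> B = \<tau> C"
  shows "u_count (signed_word \<beta>) k = u_count (signed_word \<alpha>) k"
proof -
  have cnt: "count_list (fst \<alpha>) X = 2" if "X \<in> {A, B, C}" for X
  proof -
    have "X \<in> set (fst \<alpha>)" using that by (auto simp: \<alpha>_def)
    then show ?thesis using nw by (simp add: nanoword_def gauss_word_def)
  qed
  have neq: "A \<noteq> B" "A \<noteq> C" "B \<noteq> C"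
    using cnt[of A] cnt[of B] by (auto simp: \<alpha>_def split: if_splits)
  have "X \<notin> set x \<and> X \<notin> set y \<and> X \<notin> set z \<and> X \<notin> set t" if "X \<in> {A, B, C}" for X
    using cnt[OF that] that neq by (auto simp: \<alpha>_def count_list_0_iff)
  then have A: "A \<notin> set x" "A \<notin> set y" "A \<notin> set z" "A \<notin> set t"
    and B: "B \<notin> set x" "B \<notin> set y" "B \<notin> set z" "B \<notin> set t"
    and C: "C \<notin> set x" "C \<notin> set y" "C \<notin> set z" "C \<notin> set t"
    by auto
  define c where "c \<longleftrightarrow> \<tau> A = Type_a"
  have type: "\<tau> A = Type_a \<longleftrightarrow> c" "\<tau> B = Type_a \<longleftrightarrow> c" "\<tau> C = Type_a \<longleftrightarrow> c"
    using types by (auto simp: c_def)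
  define u where "u = signed_from \<tau> {} x"
  define v where "v = signed_from \<tau> (set x) y"
  define v' where "v' = signed_from \<tau> (set x \<union> set y) z"
  define v'' where "v'' = signed_from \<tau> (set x \<union> set y \<union> set z) t"
  have nABC: "(X, d) \<notin> set u" "(X, d) \<notin> set v" "(X, d) \<notin> set v'" "(X, d) \<notin> set v''"
    if "X \<in> {A, B, C}" for X d
    using A B C that by (auto simp: u_def v_def v'_def v''_def dest: set_signed_fromD)
  \<comment> \<open>The signs in \<open>y\<close> do not depend on which of \<open>A\<close>,
    \<open>B\<close>, \<open>C\<close> have been read. Ignoring these three letters in
    \<open>S\<close> lets the same fact serve both words.\<close>
  have eqs: "signed_from \<tau> S y = v" if "S - {A, B, C} = set x" for S
    unfolding v_def using A B C that by (intro signed_from_cong) blast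
  have eqs': "signed_from \<tau> S z = v'" if "S - {A, B, C} = set x \<union> set y" for S
    unfolding v'_def using A B C that by (intro signed_from_cong) blast
  have eqs'': "signed_from \<tau> S t = v''" if "S - {A, B, C} = set x \<union> set y \<union> set z" for S
    unfolding v''_def using A B C that by (intro signed_from_cong) blast
  define p where "p = u @ [(A, c), (B, c)] @ v @ [(A, \<not> c), (C, c)] @ v' @ [(B, \<not> c), (C, \<not> c)] @ v''"
  define q where "q = u @ [(B, c), (A, c)] @ v @ [(C, c), (A, \<not> c)] @ v' @ [(C, \<not> c), (B, \<not> c)] @ v''"
  have \<alpha>: "signed_word \<alpha> = p"
    unfolding p_def \<alpha>_def signed_word_def fst_conv snd_conv signed_from_append signed_from.simps u_def[symmetric]
    using A B C neq by (subst eqs, force, subst eqs', force, subst eqs'', force) (auto simp: type)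
  have \<beta>: "signed_word \<beta> = q"
    unfolding q_def \<beta>_def signed_word_def fst_conv snd_conv signed_from_append signed_from.simps u_def[symmetric]
    using A B C neq by (subst eqs, force, subst eqs', force, subst eqs'', force) (auto simp: type)
  have "index q X = index p X" for X
  proof (cases "X \<in> {A, B, C}")
    case True
    then show ?thesis
      using neq nABC[of A] nABC[of B] nABC[of C]
      by (cases c) (auto simp: p_def q_def index_def level_append)
  next
    case False
    then have "X \<noteq> A" "X \<noteq> B" "X \<noteq> C" "A \<noteq> X" "B \<noteq> X" "C \<noteq> X" by auto
    then show ?thesis
      by (cases c) (simp_all add: p_def q_def index_def level_append)
  qed
  moreover have "fst ` set q = fst ` set p"
    by (auto simp: p_def q_def image_Un)
  ultimately show ?thesis
    unfolding \<alpha> \<beta> u_count_def by simp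
qed

lemma u_count_move:
  assumes "move \<alpha> \<beta>" "nanoword \<alpha>" "nanoword \<beta>"
  shows "u_count (signed_word \<beta>) k = u_count (signed_word \<alpha>) k"
  using assms
proof cases
  case shift
  then show ?thesis using assms by (intro u_count_shift)
next
  case H1
  then show ?thesis using assms by (intro u_count_H1)
next
  case H2
  then show ?thesis using assms by (intro u_count_H2)
next
  case H3
  then show ?thesis using assms by (intro u_count_H3)
qed

lemma u_poly_homotopic:
  assumes "homotopic \<alpha> \<beta>"
  shows "u_poly \<beta> = u_poly \<alpha>"
  using assms unfolding homotopic_def
proof (induction rule: equivclp_induct)
  case (step \<beta> \<gamma>)
  then have "nanoword \<beta>" "nanoword \<gamma>" by auto
  moreover have "u_count (signed_word \<gamma>) k = u_count (signed_word \<beta>) k" for k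
    using step.hyps(2) by (auto simp: u_count_isomorphic u_count_move)
  ultimately have "u_poly \<gamma> = u_poly \<beta>"
    by (intro poly_eqI) (simp add: coeff_u_poly u_coeff_eq_u_count)
  then show ?case using step.IH by simp
qed simp

lemma u_poly_isomorphic:
  assumes "isomorphic \<alpha> \<beta>" "nanoword \<alpha>" "nanoword \<beta>"
  shows "u_poly \<beta> = u_poly \<alpha>"
  by (rule poly_eqI)
    (simp add: coeff_u_poly u_coeff_eq_u_count[OF assms(2)] u_coeff_eq_u_count[OF assms(3)]
      u_count_isomorphic[OF assms(1)])


section \<open>Signed words of cables\<close>

lemma level_eq_height_takeWhile: "level s e = height (takeWhile (\<lambda>f. f \<noteq> e) s)"
  by (induction s) auto

lemma takeWhile_neq_append:
  "takeWhile (\<lambda>f. f \<noteq> e) (s @ t) =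
     (if e \<in> set s then takeWhile (\<lambda>f. f \<noteq> e) s else s @ takeWhile (\<lambda>f. f \<noteq> e) t)"
  by (auto simp: takeWhile_append)

lemma before_total:
  "e \<noteq> f \<Longrightarrow> e \<in> set s \<Longrightarrow>
   e \<in> set (takeWhile (\<lambda>x. x \<noteq> f) s) \<longleftrightarrow> f \<notin> set (takeWhile (\<lambda>x. x \<noteq> e) s)"
  by (induction s) auto

lemma signed_word_before:
  assumes "nanoword \<alpha>" "X \<in> set (fst \<alpha>)"
  shows "(X, False) \<in> set (takeWhile (\<lambda>e. e \<noteq> (X, True)) (signed_word \<alpha>)) \<longleftrightarrow>
    snd \<alpha> X \<noteq> Type_a"
proof -
  have gw: "gauss_word (fst \<alpha>)" using assms(1) by (simp add: nanoword_def)
  obtain x y z where w: "fst \<alpha> = x @ X # y @ X # z"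
    and X: "X \<notin> set x" "X \<notin> set y" "X \<notin> set z"
    using gw assms(2) by (rule gauss_word_split)
  show ?thesis
    unfolding signed_word_def w signed_from_append
    using X by (cases "snd \<alpha> X") (simp_all add: takeWhile_neq_append signed_from_append)
qed

text \<open>\<open>signed_from\<close> decides signs by whether a letter has been read before. The
  hypothesis \<open>before\<close> says which of the two entries of a letter is read first, and so
  forces the signs already present in \<open>S\<close>. It serves to identify the signed word of the
  cable.\<close>

lemma signed_from_eqI:
  assumes S: "balanced S"
    and before: "\<And>X. X \<in> fst ` set S \<Longrightarrow>
      (X, False) \<in> set (takeWhile (\<lambda>e. e \<noteq> (X, True)) S) \<longleftrightarrow> \<tau> X \<noteq> Type_a"
  shows "signed_from \<tau> {} (map fst S) = S"
proof -
  \<comment> \<open>Generalised to suffixes of \<open>S\<close>; the letters of the prefix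
    \<open>u\<close> are those already read.\<close>
  have "signed_from \<tau> (fst ` set u) (map fst v) = v" if "S = u @ v" for u v
    using that
  proof (induction v arbitrary: u)
    case (Cons e v)
    obtain X c where e: "e = (X, c)" by (cases e)
    have "distinct S" using S by (simp add: balanced_def)
    then have "(X, c) \<notin> set u" by (simp add: Cons.prems e)
    then have u: "u = takeWhile (\<lambda>f. f \<noteq> (X, c)) S"
      by (simp add: Cons.prems e takeWhile_neq_append)
    have X: "X \<in> fst ` set S" by (force simp: Cons.prems e)
    then have mem: "(X, d) \<in> set S" for d
      using S unfolding balanced_def by (metis UNIV_I mem_Sigma_iff)
    \<comment> \<open>As \<open>S\<close> has no repeated entries, a letter read before can only
      have been read with the opposite sign.\<close>
    have "X \<in> fst ` set u \<longleftrightarrow> (X, \<not> c) \<in> set u"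
      using \<open>(X, c) \<notin> set u\<close> by (cases c) (auto simp: image_iff Bex_def split_paired_Ex ex_bool_eq)
    also have "\<dots> \<longleftrightarrow> c = (\<tau> X \<noteq> Type_a)"
      using before[OF X] before_total[of "(X, True)" "(X, False)" S] mem u by (cases c) auto
    finally have "((X \<notin> fst ` set u) = (\<tau> X = Type_a)) = c" by auto
    moreover have "signed_from \<tau> (insert X (fst ` set u)) (map fst v) = v"
      using Cons.IH[of "u @ [e]"] Cons.prems by (simp add: e)
    ultimately show ?case by (simp add: e)
  qed simp
  from this[of "[]" S] show ?thesis by simp
qed

lemma gauss_word_map_fst:
  assumes "balanced s"
  shows "gauss_word (map fst s)"
  unfolding gauss_word_def
proof
  fix X assume "X \<in> set (map fst s)"
  then have X: "X \<in> fst ` set s" by simp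
  have "count_list (map fst s) X = length (filter (\<lambda>e. fst e = X) s)"
    by (induction s) auto
  also have "\<dots> = card {e \<in> set s. fst e = X}"
    using assms by (simp add: balanced_def distinct_length_filter Int_def conj_commute)
  also have "{e \<in> set s. fst e = X} = {(X, True), (X, False)}"
  proof -
    have "(X, d) \<in> set s" for d
      using assms X unfolding balanced_def by (metis UNIV_I mem_Sigma_iff)
    moreover have "e = (X, True) \<or> e = (X, False)" if "fst e = X" for e
      using that by (cases e) auto
    ultimately show ?thesis by auto
  qed
  finally show "count_list (map fst s) X = 2" by simp
qed

text \<open>Brings signed words into the position-indexed form used by
  \<open>cable_strand\<close>.\<close>

lemma signed_from_conv_nth:
  "signed_from \<tau> S w = map (\<lambda>p. (w ! p, (w ! p \<notin> S \<union> set (take p w)) = (\<tau> (w ! p) = Type_a)))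
     [0..<length w]"
proof (induction w arbitrary: S)
  case (Cons X w)
  show ?case
    unfolding length_Cons map_upt_Suc signed_from.simps Cons.IH by simp
qed simp

lemma distinct_concat_map:
  assumes "distinct xs" "\<And>x. x \<in> set xs \<Longrightarrow> distinct (f x)"
    and "\<And>x y. x \<in> set xs \<Longrightarrow> y \<in> set xs \<Longrightarrow> x \<noteq> y \<Longrightarrow> set (f x) \<inter> set (f y) = {}"
  shows "distinct (concat (map f xs))"
  using assms
proof (induction xs)
  case (Cons x xs)
  have "distinct (concat (map f xs))"
    using Cons.prems by (intro Cons.IH) auto
  moreover have "set (f x) \<inter> set (f y) = {}" if "y \<in> set xs" for y
    using Cons.prems(1) that by (intro Cons.prems(3)) auto
  then have "set (f x) \<inter> (\<Union>y\<in>set xs. set (f y)) = {}"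
    by blast
  ultimately show ?case
    using Cons.prems(2)[of x] by simp
qed simp

text \<open>Reduces the position of an entry in a strand of the cable to the position of its block,
  that is, to a position in the original signed word.\<close>

lemma takeWhile_concat_map:
  assumes "e \<in> set (f a)" "a \<in> set xs" "\<And>x. x \<in> set xs \<Longrightarrow> e \<in> set (f x) \<Longrightarrow> x = a"
  shows "takeWhile (\<lambda>y. y \<noteq> e) (concat (map f xs)) =
    concat (map f (takeWhile (\<lambda>x. x \<noteq> a) xs)) @ takeWhile (\<lambda>y. y \<noteq> e) (f a)"
  using assms(2,3)
proof (induction xs)
  case (Cons x xs)
  show ?case
  proof (cases "x = a")
    case True
    then show ?thesis using assms(1) by (simp add: takeWhile_neq_append)
  next
    case False
    then have "e \<notin> set (f x)" using Cons.prems(2)[of x] by auto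
    moreover have "takeWhile (\<lambda>y. y \<noteq> e) (concat (map f xs)) =
        concat (map f (takeWhile (\<lambda>x. x \<noteq> a) xs)) @ takeWhile (\<lambda>y. y \<noteq> e) (f a)"
      using Cons.prems False by (intro Cons.IH) auto
    ultimately show ?thesis using False by (simp add: takeWhile_neq_append)
  qed
qed simp

lemma height_map_const: "height (map (\<lambda>x. (g x, c)) xs) = (if c then 1 else -1) * int (length xs)"
  by (induction xs) auto

text \<open>
  In strand \<open>i\<close>, the positive occurrence of \<open>A\<close> becomes the letters \<open>Sub A (row n (\<tau> A) i) j\<close>
  with increasing \<open>j\<close>; the negative one becomes the letters \<open>Sub A k i\<close> with \<open>k\<close> running through
  \<open>descent n (\<tau> A)\<close>.
\<close>

fun row :: "nat \<Rightarrow> letter_type \<Rightarrow> nat \<Rightarrow> nat" where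
  "row n Type_a i = i"
| "row n Type_b i = (i + 1) mod n"

text \<open>Inverse of \<open>row\<close> on indices below \<open>n\<close>: the strand that
  contains the positive entry of a letter with first index \<open>i\<close>. For type b it is the
  residue of \<open>i - 1\<close> that appears in \<open>cable_type\<close>.\<close>

fun unrow :: "nat \<Rightarrow> letter_type \<Rightarrow> nat \<Rightarrow> nat" where
  "unrow n Type_a i = i"
| "unrow n Type_b i = (i + n - 1) mod n"

fun descent :: "nat \<Rightarrow> letter_type \<Rightarrow> nat list" where
  "descent n Type_a = rev [0..<n]"
| "descent n Type_b = 0 # rev [1..<n]"

lemma unrow_less: "i < n \<Longrightarrow> unrow n t i < n"
  by (cases t) auto

lemma row_less: "i < n \<Longrightarrow> row n t i < n"
  by (cases t) auto

lemma row_unrow [simp]: "i < n \<Longrightarrow> row n t (unrow n t i) = i"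
proof (cases t)
  case Type_b
  assume i: "i < n"
  show ?thesis
  proof (cases i)
    case (Suc m)
    then have "(m + n) mod n = m" using i by simp
    then show ?thesis using i by (simp add: Type_b Suc)
  qed (use i in \<open>simp add: Type_b\<close>)
qed simp

lemma unrow_row [simp]: "i < n \<Longrightarrow> unrow n t (row n t i) = i"
proof (cases t)
  case Type_b
  assume i: "i < n"
  show ?thesis
  proof (cases "Suc i = n")
    case False
    then have "Suc i < n" using i by simp
    then show ?thesis using i by (simp add: Type_b)
  qed (use i in \<open>auto simp: Type_b\<close>)
qed simp

lemma set_descent [simp]: "n \<ge> 1 \<Longrightarrow> set (descent n t) = {0..<n}"
  by (cases t) auto

lemma distinct_descent [simp]: "distinct (descent n t)"
  by (cases t) auto

text \<open>For both types \<open>descent\<close> lists the indices by decreasing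
  \<open>unrow\<close>, so exactly \<open>n - 1 - unrow n t i\<close> entries precede
  \<open>i\<close>. In type b the index 0 comes first because its \<open>unrow\<close> is
  \<open>n - 1\<close>.\<close>

lemma descent_split:
  assumes "i < n"
  obtains us vs where "descent n t = us @ i # vs" "length us + unrow n t i + 1 = n" "i \<notin> set us"
proof -
  have split: "rev [m..<n] = rev [Suc i..<n] @ i # rev [m..<i]" if "m \<le> i" for m
    using that assms upt_add_eq_append[of m i "n - i"] by (simp add: upt_conv_Cons)
  show thesis
  proof (cases t)
    case Type_a
    show thesis using assms split[of 0] by (intro that[of "rev [Suc i..<n]"]) (auto simp: Type_a)
  next
    case Type_b
    show thesis
    proof (cases i)
      case 0
      then show thesis using assms by (intro that[of "[]"]) (auto simp: Type_b)
    next
      case (Suc m)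
      have "(m + n) mod n = m" using assms Suc by simp
      then show thesis
        using assms split[of 1] Suc
        by (intro that[of "0 # rev [Suc i..<n]"]) (auto simp: Type_b)
    qed
  qed
qed

section \<open>Blocks and strands of the cable\<close>

context
  fixes n :: nat and \<tau> :: "'x \<Rightarrow> letter_type" and s :: "('x \<times> bool) list"
begin

fun block :: "nat \<Rightarrow> 'x \<times> bool \<Rightarrow> ('x cable_letter \<times> bool) list" where
  "block r (A, True) = map (\<lambda>j. (Sub A (row n (\<tau> A) r) j, True)) [0..<n]"
| "block r (A, False) = map (\<lambda>i. (Sub A i r, False)) (descent n (\<tau> A))"

definition strand :: "nat \<Rightarrow> ('x cable_letter \<times> bool) list" where
  "strand r = concat (map (block r) s)"

definition strands_below :: "nat \<Rightarrow> ('x cable_letter \<times> bool) list" where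
  "strands_below r = concat (map (\<lambda>i. strand i @ [(Conn i, True)]) [0..<r])"

text \<open>The signs are inherited from the entries of \<open>s\<close> instead of being computed
  from \<open>cable_type\<close>; \<open>signed_word_cable\<close> shows that the two agree.\<close>

definition signed_cable :: "('x cable_letter \<times> bool) list" where
  "signed_cable = strands_below (n - 1) @ strand (n - 1) @
     map (\<lambda>i. (Conn i, False)) (rev [0..<n - 1])"

lemma height_block: "n \<ge> 1 \<Longrightarrow> height (block r e) = (if snd e then 1 else -1) * int n"
proof (cases e)
  case (Pair A c)
  assume "n \<ge> 1"
  then have "length (descent n (\<tau> A)) = n" by (cases "\<tau> A") auto
  then show ?thesis
    using height_map_const[of "\<lambda>j. Sub A (row n (\<tau> A) r) j" True "[0..<n]"]
      height_map_const[of "\<lambda>i. Sub A i r" False "descent n (\<tau> A)"]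
    by (cases c) (simp_all add: Pair)
qed

lemma height_blocks:
  assumes "n \<ge> 1"
  shows "height (concat (map (block r) t)) = int n * height t"
  by (induction t) (auto simp: height_block[OF assms] algebra_simps)

lemma strands_below_Suc: "strands_below (Suc r) = strands_below r @ strand r @ [(Conn r, True)]"
  by (simp add: strands_below_def)

end

context
  fixes n :: nat and \<alpha> :: "'x nanoword"
  assumes n: "n \<ge> 1" and nw: "nanoword \<alpha>"
begin

private abbreviation "\<tau> \<equiv> snd \<alpha>"
private abbreviation "s \<equiv> signed_word \<alpha>"
private abbreviation "blk \<equiv> block n \<tau>"
private abbreviation "str \<equiv> strand n \<tau> s"
private abbreviation "below \<equiv> strands_below n \<tau> s"
private abbreviation "S \<equiv> signed_cable n \<tau> s"

lemma mem_s_iff: "(A, c) \<in> set s \<longleftrightarrow> A \<in> set (fst \<alpha>)"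
proof -
  have "set s = fst ` set s \<times> UNIV"
    using balanced_signed_word[OF nw] by (simp add: balanced_def)
  then have "set s = set (fst \<alpha>) \<times> UNIV"
    by (simp add: signed_word_def)
  then show ?thesis by simp
qed

lemma set_block:
  "set (blk r (A, c)) = (if c then {(Sub A (row n (\<tau> A) r) j, True) | j. j < n}
     else {(Sub A i r, False) | i. i < n})"
  using n by (cases c) auto

lemma Conn_notin_block: "(Conn i, c) \<notin> set (blk r e)"
  by (cases e; cases "snd e") (auto simp: set_block)

text \<open>An entry of a block shows its letter and sign, and also its strand: a positive one
  through the first index, as \<open>row\<close> is invertible, and a negative one as the second
  index.\<close>

lemma block_disjoint:
  assumes "f \<in> set (blk r e)" "f \<in> set (blk r' e')" "r < n" "r' < n"
  shows "r = r' \<and> e = e'"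
proof -
  obtain A c where e: "e = (A, c)" by (cases e)
  obtain A' c' where e': "e' = (A', c')" by (cases e')
  have "A = A' \<and> c = c'" using assms unfolding e e' set_block by (auto split: if_splits)
  moreover have "r = r'"
  proof (cases c)
    case True
    then have "row n (\<tau> A) r = row n (\<tau> A) r'"
      using assms calculation unfolding e e' set_block by auto
    then show ?thesis using assms(3,4) by (metis unrow_row)
  next
    case False
    then show ?thesis
      using assms calculation unfolding e e' set_block by auto
  qed
  ultimately show ?thesis by (simp add: e e')
qed

lemma distinct_block: "distinct (blk r e)"
proof (cases e)
  case (Pair A c)
  then show ?thesis by (cases c) (auto simp: distinct_map inj_on_def)
qed

lemma Conn_notin_strand: "(Conn i, c) \<notin> set (str r)"
  by (auto simp: strand_def Conn_notin_block)

lemma mem_strand: "f \<in> set (str r) \<longleftrightarrow> (\<exists>e\<in>set s. f \<in> set (blk r e))"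
  by (auto simp: strand_def)

lemma strand_disjoint:
  "f \<in> set (str r) \<Longrightarrow> f \<in> set (str r') \<Longrightarrow> r < n \<Longrightarrow> r' < n \<Longrightarrow> r = r'"
  unfolding mem_strand using block_disjoint by blast

lemma distinct_strand:
  assumes "r < n"
  shows "distinct (str r)"
  unfolding strand_def
proof (rule distinct_concat_map)
  show "distinct s" using balanced_signed_word[OF nw] by (simp add: balanced_def)
  show "set (blk r e) \<inter> set (blk r e') = {}" if "e \<noteq> e'" for e e'
    using block_disjoint[OF _ _ assms assms] that by blast
qed (rule distinct_block)

lemma mem_strands_below:
  "f \<in> set (below r) \<longleftrightarrow> (\<exists>i<r. f \<in> set (str i) \<or> f = (Conn i, True))"
  by (auto simp: strands_below_def)

lemma mem_signed_cable:
  "f \<in> set S \<longleftrightarrow> (\<exists>r<n. f \<in> set (str r)) \<or> (\<exists>i c. i < n - 1 \<and> f = (Conn i, c))"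
proof -
  have *: "r < n \<longleftrightarrow> r < n - 1 \<or> r = n - 1" for r using n by linarith
  show ?thesis
    unfolding signed_cable_def set_append Un_iff mem_strands_below *
    by (auto simp: ex_bool_eq)
qed

lemma Sub_mem_signed_cable:
  "(Sub A i j, c) \<in> set S \<longleftrightarrow> A \<in> set (fst \<alpha>) \<and> i < n \<and> j < n"
proof
  assume "(Sub A i j, c) \<in> set S"
  then obtain r B d where r: "r < n" "(B, d) \<in> set s" "(Sub A i j, c) \<in> set (blk r (B, d))"
    by (auto simp: mem_signed_cable mem_strand)
  then show "A \<in> set (fst \<alpha>) \<and> i < n \<and> j < n"
    unfolding set_block mem_s_iff by (auto split: if_splits simp: row_less)
next
  assume A: "A \<in> set (fst \<alpha>) \<and> i < n \<and> j < n"
  \<comment> \<open>The strand in which the entry lies: its sign decides which of the two indices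
    determines it.\<close>
  define r where "r = (if c then unrow n (\<tau> A) i else j)"
  have "r < n" using A by (simp add: r_def unrow_less)
  moreover have "(Sub A i j, c) \<in> set (blk r (A, c))"
    using A by (auto simp: set_block r_def)
  moreover have "(A, c) \<in> set s" using A by (simp add: mem_s_iff)
  ultimately show "(Sub A i j, c) \<in> set S"
    by (auto simp: mem_signed_cable mem_strand)
qed

lemma Conn_mem_signed_cable: "(Conn i, c) \<in> set S \<longleftrightarrow> i < n - 1"
  by (auto simp: mem_signed_cable Conn_notin_strand)

lemma fst_set_signed_cable:
  "fst ` set S = (\<lambda>(A, i, j). Sub A i j) ` (set (fst \<alpha>) \<times> {..<n} \<times> {..<n}) \<union> Conn ` {..<n - 1}"
  (is "_ = ?L")
proof (rule set_eqI)
  fix Y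
  have "Y \<in> fst ` set S \<longleftrightarrow> (\<exists>c. (Y, c) \<in> set S)" by force
  also have "\<dots> \<longleftrightarrow> Y \<in> ?L"
    by (cases Y) (auto simp: Sub_mem_signed_cable Conn_mem_signed_cable image_iff)
  finally show "Y \<in> fst ` set S \<longleftrightarrow> Y \<in> ?L" .
qed

lemma balanced_signed_cable: "balanced S"
proof -
  have "distinct (below r)" if "r < n" for r
    unfolding strands_below_def
  proof (rule distinct_concat_map)
    fix x y assume "x \<in> set [0..<r]" "y \<in> set [0..<r]" "x \<noteq> y"
    then show "set (str x @ [(Conn x, True)]) \<inter> set (str y @ [(Conn y, True)]) = {}"
      using strand_disjoint[of _ x y] that by (auto simp: Conn_notin_strand)
  qed (use that in \<open>auto simp: distinct_strand Conn_notin_strand\<close>)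
  moreover have "set (below (n - 1)) \<inter> set (str (n - 1)) = {}"
  proof -
    have "False" if "f \<in> set (str i)" "f \<in> set (str (n - 1))" "i < n - 1" for f i
      using strand_disjoint[OF that(1,2)] that(3) by simp
    then show ?thesis by (auto simp: mem_strands_below Conn_notin_strand)
  qed
  ultimately have "distinct S"
    using n by (auto simp: signed_cable_def distinct_strand Conn_notin_strand distinct_map inj_on_def
        mem_strands_below)
  moreover have "set S = fst ` set S \<times> UNIV"
  proof -
    have "(Y, c) \<in> set S \<longleftrightarrow> (Y, d) \<in> set S" for Y c d
      by (cases Y) (simp_all add: Sub_mem_signed_cable Conn_mem_signed_cable)
    then show ?thesis by force
  qed
  ultimately show ?thesis by (simp add: balanced_def)
qed

section \<open>Levels and indices in the cable\<close>

lemma height_s: "height s = 0"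
  using balanced_signed_word[OF nw] by (rule height_balanced)

lemma height_strand: "height (str r) = 0"
  by (simp add: strand_def height_blocks[OF n] height_s)

text \<open>Whole strands have height 0, so only the positive connecting entries count.\<close>

lemma height_strands_below: "height (below r) = int r"
  by (induction r) (simp_all add: strands_below_Suc height_strand, simp add: strands_below_def)

text \<open>The last strand has no connecting letter of its own and is followed by the negative
  connecting entries; hence the condition in the second fact.\<close>

lemma signed_cable_split:
  assumes "r < n"
  obtains t where "S = below r @ str r @ t" "r < n - 1 \<Longrightarrow> \<exists>t'. t = (Conn r, True) # t'"
proof (cases "r = n - 1")
  case True
  then show thesis by (intro that) (auto simp: signed_cable_def)
next
  case False
  then have "[0..<n - 1] = [0..<r] @ r # [Suc r..<n - 1]"
    using assms upt_add_eq_append[of 0 r "n - 1 - r"] by (simp add: upt_conv_Cons)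
  then show thesis
    by (intro that) (auto simp: signed_cable_def strands_below_def)
qed

lemma takeWhile_signed_cable:
  assumes "r < n" "e \<in> set s" "f \<in> set (blk r e)"
  shows "takeWhile (\<lambda>x. x \<noteq> f) S =
    below r @ concat (map (blk r) (takeWhile (\<lambda>x. x \<noteq> e) s)) @ takeWhile (\<lambda>x. x \<noteq> f) (blk r e)"
proof -
  obtain t where S: "S = below r @ str r @ t" using assms(1) by (rule signed_cable_split)
  have f: "f \<in> set (str r)" using assms by (auto simp: mem_strand)
  have "f \<notin> set (below r)"
  proof
    assume "f \<in> set (below r)"
    then obtain i where i: "i < r" "f \<in> set (str i)"
      using f Conn_notin_strand unfolding mem_strands_below by blast
    then have "r = i" using strand_disjoint[OF f i(2)] assms(1) by simp
    then show False using i(1) by simp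
  qed
  moreover have "takeWhile (\<lambda>x. x \<noteq> f) (str r) =
      concat (map (blk r) (takeWhile (\<lambda>x. x \<noteq> e) s)) @ takeWhile (\<lambda>x. x \<noteq> f) (blk r e)"
    unfolding strand_def
    by (rule takeWhile_concat_map[where f = "blk r" and a = e, OF assms(3,2)])
      (use block_disjoint[OF _ assms(3,1,1)] in blast)
  ultimately show ?thesis using f by (simp add: S takeWhile_neq_append)
qed

text \<open>Three contributions: the connecting entries before strand \<open>r\<close>, the complete
  blocks before the one of \<open>e\<close>, each of height plus or minus \<open>n\<close>, and the
  position inside that block.\<close>

lemma level_signed_cable:
  assumes "r < n" "e \<in> set s" "f \<in> set (blk r e)"
  shows "level S f = int r + int n * level s e + level (blk r e) f"
  by (simp add: level_eq_height_takeWhile takeWhile_signed_cable[OF assms] height_blocks[OF n]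
      height_strands_below)

lemma level_block_True:
  assumes "j < n"
  shows "level (blk r (A, True)) (Sub A (row n (\<tau> A) r) j, True) = int j"
proof -
  have "[0..<n] = [0..<j] @ j # [Suc j..<n]"
    using assms upt_add_eq_append[of 0 j "n - j"] by (simp add: upt_conv_Cons)
  then have "blk r (A, True) = map (\<lambda>j. (Sub A (row n (\<tau> A) r) j, True)) ([0..<j] @ j # [Suc j..<n])"
    by (simp only: block.simps)
  then show ?thesis
    using height_map_const[of "\<lambda>j. Sub A (row n (\<tau> A) r) j" True "[0..<j]"]
    by (simp add: level_append image_iff del: block.simps)
qed

lemma level_block_False:
  assumes "i < n"
  shows "level (blk j (A, False)) (Sub A i j, False) = int (unrow n (\<tau> A) i) + 1 - int n"
proof -
  obtain us vs where us: "descent n (\<tau> A) = us @ i # vs" "length us + unrow n (\<tau> A) i + 1 = n" "i \<notin> set us"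
    using assms by (rule descent_split)
  from us(1) have "blk j (A, False) = map (\<lambda>i. (Sub A i j, False)) (us @ i # vs)"
    by (simp only: block.simps)
  moreover have "- int (length us) = int (unrow n (\<tau> A) i) + 1 - int n"
    using us(2) by linarith
  ultimately show ?thesis
    using height_map_const[of "\<lambda>i. Sub A i j" False us] us(3)
    by (simp add: level_append image_iff del: block.simps)
qed

text \<open>
  Strand \<open>i\<close> starts at level \<open>i\<close> because of the connecting letters before it; this offset and the
  positions inside the two blocks add up to exactly the missing multiple of \<open>n\<close>.
\<close>

lemma index_signed_cable_Sub:
  assumes "A \<in> set (fst \<alpha>)" "i < n" "j < n"
  shows "index S (Sub A i j) = int n * index s A"
proof -
  define r where "r = unrow n (\<tau> A) i"
  have r: "r < n" "row n (\<tau> A) r = i" using assms by (auto simp: r_def unrow_less)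
  have "level S (Sub A i j, True) = int r + int n * level s (A, True) + int j"
    using level_signed_cable[of r "(A, True)" "(Sub A i j, True)"] r assms
      level_block_True[of j r A] by (simp add: mem_s_iff set_block del: block.simps)
  \<comment> \<open>Strand number and position in the block trade places: the positive entry has
    strand offset \<open>r\<close> and position \<open>j\<close>, the negative one strand offset
    \<open>j\<close> and a position involving \<open>r\<close>. Both cancel, and what remains of the
    constants is \<open>n\<close> times the \<open>- 1\<close> in \<open>index\<close>.\<close>
  moreover have "level S (Sub A i j, False) =
      int j + int n * level s (A, False) + (int r + 1 - int n)"
    using level_signed_cable[of j "(A, False)" "(Sub A i j, False)"] assms
      level_block_False[of i j A] by (simp add: mem_s_iff set_block r_def del: block.simps)
  ultimately show ?thesis
    by (simp add: index_def algebra_simps)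
qed

lemma takeWhile_signed_cable_Conn:
  assumes "i < n - 1"
  shows "takeWhile (\<lambda>x. x \<noteq> (Conn i, True)) S = below i @ str i"
proof -
  have "i < n" using assms by simp
  then obtain t where t: "S = below i @ str i @ t"
      "i < n - 1 \<Longrightarrow> \<exists>t'. t = (Conn i, True) # t'"
    by (rule signed_cable_split) blast
  then obtain t' where "S = below i @ str i @ (Conn i, True) # t'" using assms by auto
  moreover have "(Conn i, True) \<notin> set (below i)" "(Conn i, True) \<notin> set (str i)"
    by (auto simp: mem_strands_below Conn_notin_strand)
  ultimately show ?thesis by (simp add: takeWhile_neq_append)
qed

text \<open>The positive and negative connecting entries are nested like brackets, and everything
  else between them consists of strands of height 0.\<close>

lemma index_signed_cable_Conn:
  assumes "i < n - 1"
  shows "index S (Conn i) = 0"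
proof -
  have "level S (Conn i, True) = int i"
    unfolding level_eq_height_takeWhile takeWhile_signed_cable_Conn[OF assms]
    by (simp add: height_strands_below height_strand)
  \<comment> \<open>All \<open>n - 1\<close> positive connecting entries precede, together with the
    \<open>n - 2 - i\<close> negative ones of larger number.\<close>
  moreover have "level S (Conn i, False) = int i + 1"
  proof -
    have "[0..<n - 1] = [0..<i] @ i # [Suc i..<n - 1]"
      using assms upt_add_eq_append[of 0 i "n - 1 - i"] by (simp add: upt_conv_Cons)
    then have S: "S = below (n - 1) @ str (n - 1) @ map (\<lambda>i. (Conn i, False)) (rev [Suc i..<n - 1])
        @ (Conn i, False) # map (\<lambda>i. (Conn i, False)) (rev [0..<i])"
      by (simp add: signed_cable_def)
    show ?thesis
      using height_map_const[of "Conn :: _ \<Rightarrow> 'x cable_letter" False "rev [Suc i..<n - 1]"] assms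
      unfolding S
      by (auto simp: level_append mem_strands_below Conn_notin_strand height_strands_below height_strand)
  qed
  ultimately show ?thesis by (simp add: index_def)
qed

section \<open>The signed cable as the signed word of the cable\<close>

lemma map_fst_block:
  "map fst (blk r (A, c)) =
    (if c = (\<tau> A = Type_a) then first_occurrence n (\<tau> A) r A else second_occurrence n (\<tau> A) r A)"
  by (cases c; cases "\<tau> A") (auto simp: comp_def)

lemma map_fst_strand: "map fst (str r) = cable_strand n \<alpha> r"
proof -
  have "map fst (str r) = concat (map (\<lambda>e. map fst (blk r e)) s)"
    by (simp add: strand_def map_concat comp_def)
  also have "map (\<lambda>e. map fst (blk r e)) s =
      map (\<lambda>p. let A = fst \<alpha> ! p in
                        if A \<notin> set (take p (fst \<alpha>))
                        then first_occurrence n (snd \<alpha> A) r A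
                        else second_occurrence n (snd \<alpha> A) r A)
                 [0..<length (fst \<alpha>)]"
  proof -
    have "map fst (blk r (fst \<alpha> ! p, (fst \<alpha> ! p \<notin> set (take p (fst \<alpha>))) = (\<tau> (fst \<alpha> ! p) = Type_a))) =
       (if fst \<alpha> ! p \<notin> set (take p (fst \<alpha>))
                        then first_occurrence n (snd \<alpha> (fst \<alpha> ! p)) r (fst \<alpha> ! p)
                        else second_occurrence n (snd \<alpha> (fst \<alpha> ! p)) r (fst \<alpha> ! p))" for p
      by (subst map_fst_block) auto
    then show ?thesis
      by (simp add: signed_word_def signed_from_conv_nth Let_def comp_def)
  qed
  finally show ?thesis by (simp add: cable_strand_def)
qed

lemma map_fst_signed_cable: "map fst S = fst (cable n \<alpha>)"
  by (simp add: signed_cable_def strands_below_def cable_def map_concat map_fst_strand comp_def)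

text \<open>The positive entry of \<open>Sub A i j\<close> lies in strand
  \<open>unrow n (\<tau> A) i\<close>, the negative one in strand \<open>j\<close>. The smaller
  strand comes first; within one strand the order is that of \<open>A\<close> in \<alpha>, with the
  negative entry first exactly for type b. This is the case distinction of
  \<open>cable_type\<close>.\<close>

lemma signed_cable_before:
  assumes "Y \<in> fst ` set S"
  shows "(Y, False) \<in> set (takeWhile (\<lambda>e. e \<noteq> (Y, True)) S) \<longleftrightarrow> cable_type n \<tau> Y \<noteq> Type_a"
proof (cases Y)
  case (Conn i)
  then have "i < n - 1" using assms by (auto simp: fst_set_signed_cable)
  then show ?thesis
    by (auto simp: Conn takeWhile_signed_cable_Conn mem_strands_below Conn_notin_strand)
next
  case (Sub A i j)
  then have A: "A \<in> set (fst \<alpha>)" "i < n" "j < n" using assms by (auto simp: fst_set_signed_cable)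
  define r where "r = unrow n (\<tau> A) i"
  have r: "r < n" "row n (\<tau> A) r = i" using A by (auto simp: r_def unrow_less)
  have T: "(Sub A i j, True) \<in> set (blk r (A, True))" "(A, True) \<in> set s"
    using A r by (auto simp: set_block mem_s_iff)
  have F: "(Sub A i j, False) \<in> set (blk j (A, False))" "(A, False) \<in> set s"
    using A by (auto simp: set_block mem_s_iff)
  have only: "(Sub A i j, False) \<in> set (blk q e) \<longleftrightarrow> q = j \<and> e = (A, False)" if "q < n" for q e
    using block_disjoint[OF _ F(1) that A(3)] F(1) by blast
  have "(Sub A i j, False) \<in> set (below r) \<longleftrightarrow> j < r"
  proof
    assume "(Sub A i j, False) \<in> set (below r)"
    then obtain q e where "q < r" "(Sub A i j, False) \<in> set (blk q e)"
      by (auto simp: mem_strands_below mem_strand)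
    then show "j < r" using only[of q e] r(1) by simp
  next
    assume "j < r"
    then show "(Sub A i j, False) \<in> set (below r)"
      unfolding mem_strands_below mem_strand using F by blast
  qed
  \<comment> \<open>The tie case: both entries lie in strand \<open>r\<close>, and the order of the
    two blocks of \<open>A\<close> decides.\<close>
  moreover have "(Sub A i j, False) \<in> set (concat (map (blk r) (takeWhile (\<lambda>x. x \<noteq> (A, True)) s))) \<longleftrightarrow>
      r = j \<and> \<tau> A \<noteq> Type_a"
    using only[OF r(1)] signed_word_before[OF nw A(1)] by auto
  moreover have "(Sub A i j, False) \<notin> set (takeWhile (\<lambda>x. x \<noteq> (Sub A i j, True)) (blk r (A, True)))"
    using only[OF r(1), of "(A, True)"] by (auto dest: set_takeWhileD)
  ultimately have "(Sub A i j, False) \<in> set (takeWhile (\<lambda>e. e \<noteq> (Sub A i j, True)) S) \<longleftrightarrow>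
      j < r \<or> r = j \<and> \<tau> A \<noteq> Type_a"
    unfolding takeWhile_signed_cable[OF r(1) T(2,1)] by simp
  then show ?thesis
    by (cases "\<tau> A") (auto simp: Sub r_def)
qed

lemma signed_word_cable: "signed_word (cable n \<alpha>) = S"
proof -
  have "signed_word (cable n \<alpha>) = signed_from (cable_type n \<tau>) {} (map fst S)"
    unfolding signed_word_def[of "cable n \<alpha>"] map_fst_signed_cable by (simp add: cable_def)
  also have "\<dots> = S"
    by (rule signed_from_eqI[OF balanced_signed_cable signed_cable_before])
  finally show ?thesis .
qed

lemma nanoword_cable: "nanoword (cable n \<alpha>)"
  using gauss_word_map_fst[OF balanced_signed_cable] by (simp add: nanoword_def map_fst_signed_cable)

lemma u_count_cable:
  "u_count (signed_word (cable n \<alpha>)) k =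
     int (n ^ 2) * (\<Sum>A\<in>set (fst \<alpha>). weight k (int n * index s A))"
proof -
  let ?L = "set (fst \<alpha>) \<times> {..<n} \<times> {..<n}"
  have "u_count S k = (\<Sum>Y\<in>(\<lambda>(A, i, j). Sub A i j) ` ?L. weight k (index S Y)) +
      (\<Sum>Y\<in>Conn ` {..<n - 1}. weight k (index S Y))"
    unfolding u_count_def fst_set_signed_cable by (rule sum.union_disjoint) auto
  also have "(\<Sum>Y\<in>Conn ` {..<n - 1}. weight k (index S Y)) = 0"
    by (rule sum.neutral) (auto simp: index_signed_cable_Conn)
  also have "(\<Sum>Y\<in>(\<lambda>(A, i, j). Sub A i j) ` ?L. weight k (index S Y)) =
      (\<Sum>(A, i, j)\<in>?L. weight k (index S (Sub A i j)))"
    by (subst sum.reindex) (auto simp: inj_on_def split_def)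
  also have "\<dots> = (\<Sum>(A, i, j)\<in>?L. weight k (int n * index s A))"
    by (rule sum.cong) (auto simp: index_signed_cable_Sub)
  also have "\<dots> = (\<Sum>A\<in>set (fst \<alpha>). \<Sum>i<n. \<Sum>j<n. weight k (int n * index s A))"
    by (simp add: sum.cartesian_product[symmetric] mult.assoc)
  also have "\<dots> = int (n ^ 2) * (\<Sum>A\<in>set (fst \<alpha>). weight k (int n * index s A))"
  proof -
    have "(\<Sum>i<n. \<Sum>j<n. c) = int (n ^ 2) * c" for c :: int
      by (simp add: power2_eq_square)
    then show ?thesis by (simp only: sum_distrib_left)
  qed
  finally show ?thesis by (simp add: signed_word_cable)
qed

end


section \<open>The u-polynomial of a cable\<close>

lemma weight_times:
  assumes "n \<ge> 1"
  shows "weight k (int n * m) = (if n dvd k then weight (k div n) m else 0)"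
proof (cases "n dvd k")
  case True
  then obtain l where k: "k = n * l" by (rule dvdE)
  have "int n * m = int (n * l) \<longleftrightarrow> m = int l" "int n * m = - int (n * l) \<longleftrightarrow> m = - int l"
    using assms mult_cancel_left[of "int n" m "int l"] mult_cancel_left[of "int n" m "- int l"]
    by simp_all
  then show ?thesis using assms by (simp add: weight_def k)
next
  case False
  have "int n * m \<noteq> int k \<and> int n * m \<noteq> - int k"
  proof (rule ccontr)
    assume "\<not> ?thesis"
    then have "int n dvd int k \<or> int n dvd - int k" by (metis dvd_triv_left)
    then show False using False by simp
  qed
  then show ?thesis using False by (simp add: weight_def)
qed

text \<open>Induction on \<open>p\<close>: substituting t^n into \<open>pCons a p\<close> gives a
  plus t^n times the substituted \<open>p\<close>, which moves the coefficients up by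
  \<open>n\<close>.\<close>

lemma coeff_pcompose_monom_1:
  fixes p :: "'a :: comm_semiring_1 poly"
  assumes "n \<ge> 1"
  shows "coeff (pcompose p (monom 1 n)) k = (if n dvd k then coeff p (k div n) else 0)"
proof (induction p arbitrary: k)
  case (pCons a p)
  have "coeff (pcompose (pCons a p) (monom 1 n)) k =
      (if k = 0 then a else 0) + (if k < n then 0 else coeff (pcompose p (monom 1 n)) (k - n))"
    by (simp add: pcompose_pCons coeff_monom_mult coeff_pCons split: nat.split)
  also have "\<dots> = (if n dvd k then coeff (pCons a p) (k div n) else 0)"
  proof (cases "k < n")
    case True
    \<comment> \<open>Below \<open>n\<close> the only multiple of \<open>n\<close> is 0.\<close>
    then show ?thesis by (auto dest: dvd_imp_le)
  next
    case False
    then have "k div n = Suc ((k - n) div n)" using assms by (simp add: le_div_geq)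
    moreover have "n dvd k - n \<longleftrightarrow> n dvd k" using False by (simp add: dvd_minus_self)
    ultimately show ?thesis using False assms by (simp add: pCons.IH)
  qed
  finally show ?case .
qed simp

lemma u_poly_cable:
  assumes "n \<ge> 1" "nanoword \<alpha>"
  shows "u_poly (cable n \<alpha>) = smult (int (n ^ 2)) (pcompose (u_poly \<alpha>) (monom 1 n))"
proof (rule poly_eqI)
  fix k
  have "coeff (u_poly (cable n \<alpha>)) k = (if k \<ge> 1 then int (n ^ 2) *
      (\<Sum>A\<in>set (fst \<alpha>). weight k (int n * index (signed_word \<alpha>) A)) else 0)"
    by (simp only: coeff_u_poly u_coeff_eq_u_count[OF nanoword_cable[OF assms]] u_count_cable[OF assms])
  also have "\<dots> = int (n ^ 2) * (if n dvd k then coeff (u_poly \<alpha>) (k div n) else 0)"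
  proof (cases "n dvd k")
    case True
    \<comment> \<open>\<open>u_poly\<close> has constant term 0 by definition; on multiples of
      \<open>n\<close> this guard is the same for \<open>k\<close> and for
      \<open>k div n\<close>.\<close>
    then have "k div n \<ge> 1 \<longleftrightarrow> k \<ge> 1"
      using assms(1) by (auto elim!: dvdE)
    then show ?thesis
      using True by (simp add: weight_times[OF assms(1)] coeff_u_poly
          u_coeff_eq_u_count[OF assms(2)] u_count_def signed_word_def)
  qed (simp add: weight_times[OF assms(1)])
  also have "\<dots> = coeff (smult (int (n ^ 2)) (pcompose (u_poly \<alpha>) (monom 1 n))) k"
    by (simp add: coeff_pcompose_monom_1[OF assms(1)])
  finally show "coeff (u_poly (cable n \<alpha>)) k = \<dots>" .
qed

section \<open>Passage to virtual strings\<close>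

lemma homotopic_nanoword:
  assumes "homotopic \<alpha> \<beta>" "nanoword \<alpha>"
  shows "nanoword \<beta>"
  using assms unfolding homotopic_def by (induction rule: equivclp_induct) auto

lemma isomorphic_nanoword:
  assumes "isomorphic \<alpha> \<beta>" "nanoword \<alpha>"
  shows "nanoword \<beta>"
  using assms by (auto simp: isomorphic_def nanoword_def gauss_word_def count_list_inj_map)

lemma vstring_ofD:
  assumes "\<gamma> \<in> vstring_of \<alpha>" "nanoword \<alpha>"
  shows "nanoword \<gamma>" "u_poly \<gamma> = u_poly \<alpha>"
proof -
  obtain \<beta> where \<beta>: "isomorphic \<alpha> \<beta>" "nanoword \<beta>" "homotopic \<beta> \<gamma>"
    using assms(1) by (auto simp: vstring_of_def)
  show "nanoword \<gamma>" using homotopic_nanoword[OF \<beta>(3,2)] .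
  show "u_poly \<gamma> = u_poly \<alpha>"
    using u_poly_homotopic[OF \<beta>(3)] u_poly_isomorphic[OF \<beta>(1) assms(2) \<beta>(2)] by simp
qed

text \<open>The finitely many letters can be renamed injectively to natural numbers. Nonemptiness
  ensures that \<open>the_elem\<close> in \<open>u_vstring\<close> is applied to a
  singleton.\<close>

lemma vstring_of_nonempty:
  assumes "nanoword \<alpha>"
  shows "vstring_of \<alpha> \<noteq> {}"
proof -
  obtain f :: "'a \<Rightarrow> nat" where f: "inj_on f (set (fst \<alpha>))"
    using finite_imp_inj_to_nat_seg[of "set (fst \<alpha>)"] by auto
  define \<beta> where "\<beta> = (map f (fst \<alpha>), \<lambda>i. snd \<alpha> (inv_into (set (fst \<alpha>)) f i))"
  have "isomorphic \<alpha> \<beta>"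
    unfolding isomorphic_def using f by (intro exI[of _ f]) (simp add: \<beta>_def)
  moreover from this have "nanoword \<beta>"
    using assms by (rule isomorphic_nanoword)
  moreover have "homotopic \<beta> \<beta>" by (simp add: homotopic_def)
  ultimately show ?thesis unfolding vstring_of_def by blast
qed

lemma the_elem_image_const:
  assumes "A \<noteq> {}" "\<And>x. x \<in> A \<Longrightarrow> f x = c"
  shows "the_elem (f ` A) = c"
proof -
  have "f ` A = {c}" using assms by auto
  then show ?thesis by simp
qed

theorem theorem10p2:
  fixes \<Gamma> :: "nat nanoword set" and n :: nat
  assumes "\<Gamma> \<in> virtual_strings" and "n \<ge> 1"
  shows "u_vstring (cable_vstring n \<Gamma>) =
           smult (int (n ^ 2)) (pcompose (u_vstring \<Gamma>) (monom 1 n))"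
proof -
  obtain \<alpha> :: "nat nanoword" where \<alpha>: "nanoword \<alpha>" "\<Gamma> = vstring_of \<alpha>"
    using assms(1) by (auto simp: virtual_strings_def)
  have \<Gamma>: "nanoword \<beta>" "u_poly \<beta> = u_poly \<alpha>" if "\<beta> \<in> \<Gamma>" for \<beta>
    using vstring_ofD[of \<beta> \<alpha>] that \<alpha> by auto
  have "\<Gamma> \<noteq> {}" using vstring_of_nonempty[OF \<alpha>(1)] \<alpha>(2) by simp
  then have "u_vstring \<Gamma> = u_poly \<alpha>"
    unfolding u_vstring_def using \<Gamma>(2) by (rule the_elem_image_const)
  moreover have "u_vstring (cable_vstring n \<Gamma>) =
      smult (int (n ^ 2)) (pcompose (u_poly \<alpha>) (monom 1 n))"
    unfolding u_vstring_def
  proof (rule the_elem_image_const)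
    show "cable_vstring n \<Gamma> \<noteq> {}"
      using \<open>\<Gamma> \<noteq> {}\<close> vstring_of_nonempty[OF nanoword_cable[OF assms(2) \<Gamma>(1)]]
      by (auto simp: cable_vstring_def)
  next
    \<comment> \<open>By \<open>u_poly_cable\<close> the polynomial of a cable depends only on that
      of the cabled nanoword, so every member \<beta> of \<Gamma> yields the same result as
      \<alpha>.\<close>
    fix \<gamma> assume "\<gamma> \<in> cable_vstring n \<Gamma>"
    then obtain \<beta> where \<beta>: "\<beta> \<in> \<Gamma>" "\<gamma> \<in> vstring_of (cable n \<beta>)"
      by (auto simp: cable_vstring_def)
    then have "u_poly \<gamma> = u_poly (cable n \<beta>)"
      using vstring_ofD(2) nanoword_cable[OF assms(2) \<Gamma>(1)] by blast
    then show "u_poly \<gamma> = smult (int (n ^ 2)) (pcompose (u_poly \<alpha>) (monom 1 n))"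
      using u_poly_cable[OF assms(2) \<Gamma>(1)] \<Gamma>(2) \<beta>(1) by simp
  qed
  ultimately show ?thesis by simp
qed

end
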